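(* Let $\boldsymbol{x}=(x_1,\dots,x_M)\in\mathbb{R}^M$ with $x_1<\cdots<x_M$ and $\boldsymbol{y}_0\in\mathbb{R}^M$ with $M\ge 4$, and let $f_{\mathrm{cano}}$ and $\eta_{\mathrm{cano}}$ be the canonical interpolant and the canonical dual certificate associated with $(\boldsymbol{x},\boldsymbol{y}_0)$. A function $f_{\mathrm{opt}}\in \mathrm{BV}^{(2)}(\mathbb{R})$ is a solution of (gBPC) if and only if $f_{\mathrm{opt}}(x_m)=y_{0,m}$ for all $m\in\{1,\dots,M\}$ and the following conditions are satisfied for all $m\in\{2,\dots,M-2\}$: 1. $f_{\mathrm{opt}}=f_{\mathrm{cano}}$ in $[x_m,x_{m+1}]$ if $|\eta_{\mathrm{cano}}|<1$ in $(x_m,x_{m+1})$; 2. $f_{\mathrm{opt}}$ is convex in $[x_{m-1},x_{m+2}]$ if $\eta_{\mathrm{cano}}=1$ in $[x_m,x_{m+1}]$; 3. $f_{\mathrm{opt}}$ is concave in $[x_{m-1},x_{m+2}]$ if $\eta_{\mathrm{cano}}=-1$ in $[x_m,x_{m+1}]$; 4. $f_{\mathrm{opt}}=f_{\mathrm{cano}}$ in $(-\infty,x_2)$ and $(x_{M-1},+\infty)$.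
   Context: $\mathcal{M}(\mathbb{R})$ is the space of bounded (finite, signed) Radon measures on $\mathbb{R}$, i.e. the dual of $\mathcal{C}_0(\mathbb{R})$ (continuous functions vanishing at $\pm\infty$, sup norm), with total-variation norm $\|w\|_{\mathcal{M}}=\sup\{\langle w,f\rangle: f\in\mathcal{C}_0(\mathbb{R}),\ \|f\|_\infty\le 1\}$. $\mathrm{BV}^{(2)}(\mathbb{R})=\{f\in\mathcal{S}'(\mathbb{R}):\mathrm{D}^2f\in\mathcal{M}(\mathbb{R})\}$, where $\mathrm{D}^2$ is the distributional second derivative; its elements are continuous functions. Write $(t)_+=\max(0,t)$. (gBPC) is the problem of minimizing $\|\mathrm{D}^2f\|_{\mathcal{M}}$ over all $f\in\mathrm{BV}^{(2)}(\mathbb{R})$ with $f(x_m)=y_{0,m}$ for $m=1,\dots,M$; a solution is a minimizer. The canonical interpolant is $f_{\mathrm{cano}}(x)=a_1x+a_M+\sum_{m=2}^{M-1}a_m(x-x_m)_+$, the piecewise-linear function interpolating the data $(x_m,y_{0,m})$ with knots contained in $\{x_2,\dots,x_{M-1}\}$; here $a_1=\frac{y_{0,2}-y_{0,1}}{x_2-x_1}$, $a_m=\frac{y_{0,m+1}-y_{0,m}}{x_{m+1}-x_m}-\frac{y_{0,m}-y_{0,m-1}}{x_m-x_{m-1}}$ for $2\le m\le M-1$, and $a_M=y_{0,1}-a_1x_1$. The canonical dual certificate $\eta_{\mathrm{cano}}$ is the unique function $\eta_{\mathrm{cano}}=\sum_{m=1}^Mc_m(x_m-\cdot)_+$, $\boldsymbol{c}\in\mathbb{R}^M$,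 with $\sum_mc_m=\sum_mc_mx_m=0$ and $\eta_{\mathrm{cano}}(x_m)=\mathrm{sign}(a_m)$ for $m=2,\dots,M-1$ ($\mathrm{sign}(0)=0$). Equivalently, it is the continuous function, affine on each $[x_m,x_{m+1}]$, that vanishes on $(-\infty,x_1]\cup[x_M,\infty)$ and takes the value $\mathrm{sign}(a_m)$ at $x_m$ for $2\le m\le M-1$. *)

theory Defs
  imports "HOL-Analysis.Analysis"
begin

definition C0 :: "(real \<Rightarrow> real) set" where
  "C0 = {g. continuous_on UNIV g \<and> (g \<longlongrightarrow> 0) at_top \<and> (g \<longlongrightarrow> 0) at_bot}"

definition sup_norm :: "(real \<Rightarrow> real) \<Rightarrow> real" where
  "sup_norm g = (SUP x. \<bar>g x\<bar>)"

(* Bounded Radon measures as the continuous dual of C0. Requiring the functionals to be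
   extensional makes equality in HOL coincide with equality as functionals on C0. *)
definition Radon_measures :: "((real \<Rightarrow> real) \<Rightarrow> real) set" where
  "Radon_measures = {w. w \<in> extensional C0
     \<and> (\<forall>g\<in>C0. \<forall>h\<in>C0. w (\<lambda>x. g x + h x) = w g + w h)
     \<and> (\<forall>c. \<forall>g\<in>C0. w (\<lambda>x. c * g x) = c * w g)
     \<and> (\<exists>B. \<forall>g\<in>C0. \<bar>w g\<bar> \<le> B * sup_norm g)}"

definition M_norm :: "((real \<Rightarrow> real) \<Rightarrow> real) \<Rightarrow> real" where
  "M_norm w = Sup {w g | g. g \<in> C0 \<and> sup_norm g \<le> 1}"

definition Schwartz :: "(real \<Rightarrow> real) set" where
  "Schwartz = {\<phi>. (\<forall>n x. (deriv ^^ n) \<phi> field_differentiable (at x))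
     \<and> (\<forall>k n. bounded (range (\<lambda>x. x ^ k * (deriv ^^ n) \<phi> x)))}"

definition Schwartz_seminorm :: "nat \<Rightarrow> nat \<Rightarrow> (real \<Rightarrow> real) \<Rightarrow> real" where
  "Schwartz_seminorm k n \<phi> = (SUP x. \<bar>x ^ k * (deriv ^^ n) \<phi> x\<bar>)"

(* The Schwartz topology is metrizable, so continuity of a functional is sequential continuity. *)
definition tempered_distributions :: "((real \<Rightarrow> real) \<Rightarrow> real) set" where
  "tempered_distributions = {T.
       (\<forall>\<phi>\<in>Schwartz. \<forall>\<psi>\<in>Schwartz. T (\<lambda>x. \<phi> x + \<psi> x) = T \<phi> + T \<psi>)
     \<and> (\<forall>c. \<forall>\<phi>\<in>Schwartz. T (\<lambda>x. c * \<phi> x) = c * T \<phi>)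
     \<and> (\<forall>\<phi>s. \<forall>\<phi>\<in>Schwartz. (\<forall>i::nat. \<phi>s i \<in> Schwartz)
          \<and> (\<forall>k n. (\<lambda>i. Schwartz_seminorm k n (\<lambda>x. \<phi>s i x - \<phi> x)) \<longlonglongrightarrow> 0)
          \<longrightarrow> (\<lambda>i. T (\<phi>s i)) \<longlonglongrightarrow> T \<phi>)}"

definition distr_of :: "(real \<Rightarrow> real) \<Rightarrow> (real \<Rightarrow> real) \<Rightarrow> real" where
  "distr_of f = (\<lambda>\<phi>. LINT x|lborel. f x * \<phi> x)"

definition distr_deriv :: "((real \<Rightarrow> real) \<Rightarrow> real) \<Rightarrow> (real \<Rightarrow> real) \<Rightarrow> real" where
  "distr_deriv T = (\<lambda>\<phi>. - T (deriv \<phi>))"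

definition represents_D2 :: "((real \<Rightarrow> real) \<Rightarrow> real) \<Rightarrow> (real \<Rightarrow> real) \<Rightarrow> bool" where
  "represents_D2 w f \<longleftrightarrow> w \<in> Radon_measures
     \<and> (\<forall>\<phi>\<in>Schwartz. w \<phi> = distr_deriv (distr_deriv (distr_of f)) \<phi>)"

(* A distribution whose second derivative is a bounded measure is given by a unique continuous
   function; BV2 consists of these representatives, for which point values make sense. *)
definition BV2 :: "(real \<Rightarrow> real) set" where
  "BV2 = {f. continuous_on UNIV f
     \<and> (\<forall>\<phi>\<in>Schwartz. integrable lborel (\<lambda>x. f x * \<phi> x))
     \<and> distr_of f \<in> tempered_distributions
     \<and> (\<exists>w. represents_D2 w f)}"

(* For f in BV2 the measure is unique because Schwartz is dense in C0. *)
definition D2 :: "(real \<Rightarrow> real) \<Rightarrow> (real \<Rightarrow> real) \<Rightarrow> real" where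
  "D2 f = (THE w. represents_D2 w f)"

(* Data points are indexed by {1..M}; values of x and y at other indices are irrelevant. *)
definition interpolates :: "nat \<Rightarrow> (nat \<Rightarrow> real) \<Rightarrow> (nat \<Rightarrow> real) \<Rightarrow> (real \<Rightarrow> real) \<Rightarrow> bool" where
  "interpolates M x y f \<longleftrightarrow> (\<forall>m\<in>{1..M}. f (x m) = y m)"

definition gBPC_solution :: "nat \<Rightarrow> (nat \<Rightarrow> real) \<Rightarrow> (nat \<Rightarrow> real) \<Rightarrow> (real \<Rightarrow> real) \<Rightarrow> bool" where
  "gBPC_solution M x y =
     is_arg_min (\<lambda>f. M_norm (D2 f)) (\<lambda>f. f \<in> BV2 \<and> interpolates M x y f)"

definition slope :: "(nat \<Rightarrow> real) \<Rightarrow> (nat \<Rightarrow> real) \<Rightarrow> nat \<Rightarrow> real" where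
  "slope x y m = (y (m + 1) - y m) / (x (m + 1) - x m)"

definition a_cano :: "nat \<Rightarrow> (nat \<Rightarrow> real) \<Rightarrow> (nat \<Rightarrow> real) \<Rightarrow> nat \<Rightarrow> real" where
  "a_cano M x y m =
     (if m = 1 then slope x y 1
      else if m = M then y 1 - slope x y 1 * x 1
      else slope x y m - slope x y (m - 1))"

definition f_cano :: "nat \<Rightarrow> (nat \<Rightarrow> real) \<Rightarrow> (nat \<Rightarrow> real) \<Rightarrow> real \<Rightarrow> real" where
  "f_cano M x y t = a_cano M x y 1 * t + a_cano M x y M
     + (\<Sum>m = 2..M - 1. a_cano M x y m * max 0 (t - x m))"

definition eta_cano :: "nat \<Rightarrow> (nat \<Rightarrow> real) \<Rightarrow> (nat \<Rightarrow> real) \<Rightarrow> real \<Rightarrow> real" where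
  "eta_cano M x y = (THE \<eta>. \<exists>c :: nat \<Rightarrow> real.
     \<eta> = (\<lambda>t. \<Sum>m = 1..M. c m * max 0 (x m - t))
     \<and> (\<Sum>m = 1..M. c m) = 0 \<and> (\<Sum>m = 1..M. c m * x m) = 0
     \<and> (\<forall>m\<in>{2..M - 1}. \<eta> (x m) = sgn (a_cano M x y m)))"

end

theory Submission
  imports Defs "HOL-Probability.Sinc_Integral"
begin

text \<open>
  For every admissible \<open>f\<close> the norm of the measure \<open>f''\<close> is at least its pairing with a function of sup norm at
  most 1. The canonical certificate \<open>\<eta>\<close> is a combination of hat functions at the data nodes, and pairing
  \<open>f''\<close> with a hat function gives a second divided difference of \<open>f\<close> (\<open>D2_hat\<close>). Hence the pairing with \<open>\<eta>\<close>
  depends on the data only; its value is the sum of \<open>\<bar>a m\<bar>\<close>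
  over the inner nodes. The canonical interpolant, whose second derivative consists of the masses \<open>a m\<close>,
  attains this lower bound, so \<open>f\<close> is a solution if and only if it interpolates and \<open>\<eta>\<close> attains
  the norm of \<open>f''\<close> (\<open>gBPC_solution_iff_dual\<close>). What remains is to express this extremality locally: \<open>f''\<close> must be
  carried by the set where \<open>\<bar>\<eta>\<bar> = 1\<close> and have the sign of \<open>\<eta>\<close> there.

  Hat functions suffice to test this. Piecewise linear functions are dense among the continuous functions vanishing at infinity
  (\<open>hat_approximation\<close>), so a measure is determined by its values on hats, and those of \<open>f''\<close> are the numbers
  \<open>kink f p q r\<close>, the slope changes of the chords of \<open>f\<close>.

  If \<open>\<eta>\<close> attains the norm, then adding small multiples of a hat to \<open>\<eta>\<close>, within the bound 1, cannot increase
  the pairing (\<open>kink_nonneg_of_dual_certificate\<close>). Where \<open>\<bar>\<eta>\<bar> < 1\<close> both signs are possible and \<open>f\<close> has no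
  kink, so it is the chord of the data; around an interval with \<open>\<eta> = 1\<close> only subtraction is possible and the
  kinks are nonnegative, that is, \<open>f\<close> is convex. That the three intervals around the plateau are covered rests on
  \<open>\<eta>\<close> being concave there. Conversely, under the four conditions each kink of \<open>f\<close> vanishes or has
  the sign of \<open>\<eta> = \<plusminus>1\<close> at its middle point (\<open>kink_sign\<close>), and so the pairing of \<open>f''\<close> with \<open>\<eta> - g\<close> is
  nonnegative for every \<open>g\<close> with sup norm at most 1 (\<open>minimizer_if_conditions\<close>).
\<close>

section \<open>Smooth functions and a smooth ramp\<close>

text \<open>Recursion on an explicit derivative, instead of a condition on the iterates of \<open>deriv\<close>, makes closure
under sums, products and affine substitutions a plain induction on the order.\<close>

primrec n_times_differentiable :: "nat \<Rightarrow> (real \<Rightarrow> real) \<Rightarrow> bool" where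
  "n_times_differentiable 0 g \<longleftrightarrow> True"
| "n_times_differentiable (Suc n) g \<longleftrightarrow>
     (\<exists>g'. (\<forall>t. (g has_real_derivative g' t) (at t)) \<and> n_times_differentiable n g')"

definition smooth :: "(real \<Rightarrow> real) \<Rightarrow> bool" where
  "smooth g \<longleftrightarrow> (\<forall>n. n_times_differentiable n g)"

lemma n_times_differentiable_SucD:
  "n_times_differentiable (Suc n) g \<Longrightarrow> n_times_differentiable n g"
  by (induction n arbitrary: g) (simp, metis n_times_differentiable.simps(2))

lemma n_times_differentiable_const: "n_times_differentiable n (\<lambda>t. c)"
proof (induction n arbitrary: c)
  case (Suc n)
  have "\<forall>t. ((\<lambda>t. c) has_real_derivative 0) (at t)" by auto
  then show ?case using Suc by (auto intro!: exI[of _ "\<lambda>t. 0"])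
qed simp

lemma n_times_differentiable_add:
  "n_times_differentiable n g \<Longrightarrow> n_times_differentiable n h \<Longrightarrow>
   n_times_differentiable n (\<lambda>t. g t + h t)"
proof (induction n arbitrary: g h)
  case (Suc n)
  then obtain g' h' where "\<And>t. (g has_real_derivative g' t) (at t)" "n_times_differentiable n g'"
    "\<And>t. (h has_real_derivative h' t) (at t)" "n_times_differentiable n h'" by auto
  then show ?case using Suc.IH
    by (auto intro!: exI[of _ "\<lambda>t. g' t + h' t"] derivative_eq_intros)
qed simp

lemma n_times_differentiable_mult:
  "n_times_differentiable n g \<Longrightarrow> n_times_differentiable n h \<Longrightarrow>
   n_times_differentiable n (\<lambda>t. g t * h t)"
proof (induction n arbitrary: g h)
  case (Suc n)
  then obtain g' h' where gh: "\<And>t. (g has_real_derivative g' t) (at t)" "n_times_differentiable n g'"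
    "\<And>t. (h has_real_derivative h' t) (at t)" "n_times_differentiable n h'" by auto
  have "n_times_differentiable n g" "n_times_differentiable n h"
    using Suc.prems n_times_differentiable_SucD by blast+
  then have "n_times_differentiable n (\<lambda>t. g' t * h t + g t * h' t)"
    by (intro n_times_differentiable_add Suc.IH gh)
  then show ?case using gh
    by (auto intro!: exI[of _ "\<lambda>t. g' t * h t + g t * h' t"] derivative_eq_intros)
qed simp

lemma n_times_differentiable_affine:
  "n_times_differentiable n g \<Longrightarrow> n_times_differentiable n (\<lambda>t. g (c * t + d))"
proof (induction n arbitrary: g)
  case (Suc n)
  then obtain g' where g: "\<And>t. (g has_real_derivative g' t) (at t)" "n_times_differentiable n g'"
    by auto
  have "((\<lambda>t. g (c * t + d)) has_real_derivative c * g' (c * t + d)) (at t)" for t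
    using DERIV_chain2[OF g(1), of "\<lambda>t. c * t + d" c t UNIV]
      DERIV_add[OF DERIV_cmult_Id[of c t UNIV] DERIV_const[of d]]
    by (simp add: mult.commute)
  moreover have "n_times_differentiable n (\<lambda>t. c * g' (c * t + d))"
    by (intro n_times_differentiable_mult n_times_differentiable_const Suc.IH g)
  ultimately show ?case by (auto intro!: exI[of _ "\<lambda>t. c * g' (c * t + d)"])
qed simp

lemma smooth_const: "smooth (\<lambda>t. c)"
  and smooth_add: "smooth g \<Longrightarrow> smooth h \<Longrightarrow> smooth (\<lambda>t. g t + h t)"
  and smooth_mult: "smooth g \<Longrightarrow> smooth h \<Longrightarrow> smooth (\<lambda>t. g t * h t)"
  and smooth_affine: "smooth g \<Longrightarrow> smooth (\<lambda>t. g (c * t + d))"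
  by (simp_all add: smooth_def n_times_differentiable_const n_times_differentiable_add
      n_times_differentiable_mult n_times_differentiable_affine)

lemma smooth_diff: "smooth g \<Longrightarrow> smooth h \<Longrightarrow> smooth (\<lambda>t. g t - h t)"
  using smooth_add[of g "\<lambda>t. - 1 * h t"] smooth_mult[OF smooth_const[of "-1"], of h] by simp

lemma smooth_antiderivative:
  assumes "smooth g'" "\<And>t. (g has_real_derivative g' t) (at t)"
  shows "smooth g"
  unfolding smooth_def
proof
  fix n show "n_times_differentiable n g"
    using assms by (cases n) (auto simp: smooth_def)
qed

text \<open>Derivatives are unique, so the witnesses hidden in \<open>smooth\<close> are the iterates of \<open>deriv\<close>; this is the
bridge to the derivatives that occur in \<open>Schwartz\<close>.\<close>

lemma smooth_imp_deriv:
  assumes "smooth g"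
  shows "smooth (deriv g)" "\<And>t. (g has_real_derivative deriv g t) (at t)"
proof -
  have ex: "\<exists>g'. (\<forall>t. (g has_real_derivative g' t) (at t)) \<and> n_times_differentiable n g'" for n
    using assms unfolding smooth_def by (metis n_times_differentiable.simps(2))
  have eq: "deriv g = g'" if "\<forall>t. (g has_real_derivative g' t) (at t)" for g'
    using that DERIV_imp_deriv by blast
  show "smooth (deriv g)" unfolding smooth_def using ex eq by metis
  show "(g has_real_derivative deriv g t) (at t)" for t using ex[of 0] eq by metis
qed

lemma smooth_funpow_deriv: "smooth g \<Longrightarrow> smooth ((deriv ^^ n) g)"
  by (induction n) (auto intro: smooth_imp_deriv)

text \<open>The complement of the interval is open, so all derivatives vanish on it; on the interval everything is
bounded by compactness.\<close>

lemma compactly_supported_smooth_Schwartz: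
  assumes "smooth g" and supp: "\<And>t. t \<notin> {a..b} \<Longrightarrow> g t = 0"
  shows "g \<in> Schwartz"
proof -
  have supp_n: "(deriv ^^ n) g t = 0" if "t \<notin> {a..b}" for n t
    using that
  proof (induction n arbitrary: t)
    case (Suc n)
    have "open (- {a..b})" by (simp add: open_Compl)
    then have "((deriv ^^ n) g has_real_derivative 0) (at t)"
      using Suc has_field_derivative_transform_within_open
        [OF DERIV_const[of 0 "at t"], of "- {a..b}" "(deriv ^^ n) g"] by auto
    then show ?case by (simp add: DERIV_imp_deriv)
  qed (use supp in auto)
  have "bounded (range (\<lambda>t. t ^ k * (deriv ^^ n) g t))" for k n
  proof -
    have "continuous_on {a..b} ((deriv ^^ n) g)"
      using smooth_imp_deriv(2)[OF smooth_funpow_deriv[OF assms(1), of n]]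
      by (meson DERIV_atLeastAtMost_imp_continuous_on)
    then have "compact ((\<lambda>t. t ^ k * (deriv ^^ n) g t) ` {a..b})"
      by (intro compact_continuous_image continuous_intros) auto
    then have "bounded (insert 0 ((\<lambda>t. t ^ k * (deriv ^^ n) g t) ` {a..b}))"
      by (simp add: compact_imp_bounded)
    then show ?thesis
      by (rule bounded_subset) (use supp_n[of _ n] in force)
  qed
  moreover have "(deriv ^^ n) g field_differentiable (at t)" for n t
    using smooth_imp_deriv(2)[OF smooth_funpow_deriv[OF assms(1), of n]]
    by (auto simp: field_differentiable_def)
  ultimately show ?thesis by (auto simp: Schwartz_def)
qed

text \<open>For \<open>p = 1\<close> this is the classical function \<open>exp (- 1 / t)\<close> that is flat at 0. The polynomial factor in
\<open>1 / t\<close> makes the family closed under differentiation.\<close>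

definition flat_exp :: "real poly \<Rightarrow> real \<Rightarrow> real" where
  "flat_exp p t = (if t > 0 then poly p (inverse t) * exp (- inverse t) else 0)"

lemma poly_times_exp_tendsto_0: "((\<lambda>u. poly p u * exp (- u)) \<longlongrightarrow> (0::real)) at_top"
proof -
  have "((\<lambda>u. \<Sum>i\<le>degree p. coeff p i * (u ^ i / exp u)) \<longlongrightarrow> (\<Sum>i\<le>degree p. coeff p i * 0)) at_top"
    by (intro tendsto_intros tendsto_power_div_exp_0)
  then show ?thesis
    by (simp add: poly_altdef exp_minus sum_divide_distrib field_simps)
qed

lemma flat_exp_tendsto_0: "(flat_exp p \<longlongrightarrow> 0) (at 0)"
proof -
  have "((\<lambda>t. poly p (inverse t) * exp (- inverse t)) \<longlongrightarrow> 0) (at_right (0::real))"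
    using filterlim_compose[OF poly_times_exp_tendsto_0 filterlim_inverse_at_top_right] by simp
  then have "(flat_exp p \<longlongrightarrow> 0) (at_right 0)"
    by (rule Lim_transform_eventually)
       (auto simp: flat_exp_def eventually_at_right_field intro!: exI[of _ 1])
  moreover have "(flat_exp p \<longlongrightarrow> 0) (at_left 0)"
    by (rule Lim_transform_eventually[OF tendsto_const])
       (auto simp: flat_exp_def eventually_at_left_field intro!: exI[of _ "-1"])
  ultimately show ?thesis by (simp add: filterlim_at_split)
qed

lemma flat_exp_has_derivative:
  "(flat_exp p has_real_derivative flat_exp (monom 1 2 * (p - pderiv p)) t) (at t)"
proof -
  consider "t < 0" | "t > 0" | "t = 0" by linarith
  then show ?thesis
  proof cases
    case 1
    have "(flat_exp p has_real_derivative 0) (at t)"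
      by (rule has_field_derivative_transform_within_open[of "\<lambda>_. 0" 0 t "{..<0}"])
         (use 1 in \<open>auto simp: flat_exp_def\<close>)
    then show ?thesis using 1 by (simp add: flat_exp_def)
  next
    case 2
    have "((\<lambda>t. poly p (inverse t) * exp (- inverse t)) has_real_derivative
        flat_exp (monom 1 2 * (p - pderiv p)) t) (at t)"
      using 2 by (auto intro!: derivative_eq_intros poly_DERIV
          simp: flat_exp_def poly_monom power2_eq_square algebra_simps)
    then show ?thesis
      by (rule has_field_derivative_transform_within_open[of _ _ t "{0<..}"])
         (use 2 in \<open>auto simp: flat_exp_def\<close>)
  next
    case 3
    \<comment> \<open>The difference quotient at 0 is again of the same form, with \<open>p(X)\<close> replaced by \<open>X p(X)\<close>.\<close>
    have "flat_exp p h / h = flat_exp (pCons 0 p) h" for h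
      by (auto simp: flat_exp_def field_simps)
    then show ?thesis
      using 3 flat_exp_tendsto_0[of "pCons 0 p"]
      by (simp add: has_field_derivative_iff flat_exp_def[of _ 0])
  qed
qed

lemma smooth_flat_exp: "smooth (flat_exp p)"
proof -
  have "n_times_differentiable n (flat_exp p)" for n
    by (induction n arbitrary: p) (use flat_exp_has_derivative in auto)
  then show ?thesis by (simp add: smooth_def)
qed

lemma smooth_continuous: "smooth g \<Longrightarrow> continuous_on A g"
  by (meson DERIV_continuous_on has_field_derivative_at_within smooth_imp_deriv(2))

lemma antiderivative_exists:
  fixes b :: "real \<Rightarrow> real"
  assumes "continuous_on UNIV b"
  shows "\<exists>H. H 0 = 0 \<and> (\<forall>t. (H has_real_derivative b t) (at t))"
proof -
  obtain F where "\<forall>t. (F has_vector_derivative b t) (at t)"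
    using einterval_antiderivative[of "-\<infinity>" "\<infinity>" b] assms
    by (auto simp: continuous_on_eq_continuous_at)
  then show ?thesis
    by (intro exI[of _ "\<lambda>t. F t - F 0"])
       (auto simp: has_real_derivative_iff_has_vector_derivative intro!: derivative_eq_intros)
qed

lemma DERIV_zero_on_convex_const:
  fixes g g' :: "real \<Rightarrow> real"
  assumes "\<And>t. (g has_real_derivative g' t) (at t)" "\<And>t. t \<in> S \<Longrightarrow> g' t = 0"
    "convex S" "a \<in> S" "t \<in> S"
  shows "g t = g a"
proof -
  have "(g has_derivative (\<lambda>_. 0)) (at u within S)" if "u \<in> S" for u
    using assms(1)[of u] assms(2)[OF that]
    by (metis has_field_derivative_at_within has_field_derivative_def lambda_zero)
  then show ?thesis using has_derivative_zero_unique[of S g a t] assms by auto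
qed

text \<open>Integrating a normalised bump \<open>b\<close> on \<open>[0, 1]\<close> twice gives a smooth function that is 0 to the left of the
support and affine with slope 1 to the right of it, hence at bounded distance from the ramp \<open>max 0 t\<close>.\<close>

lemma smooth_ramp_exists:
  "\<exists>G b C k. smooth G \<and> (\<forall>t. (deriv G has_real_derivative b t) (at t)) \<and>
     (\<forall>t\<le>0. G t = 0) \<and> (\<forall>t\<ge>1. G t = t - k) \<and> (\<forall>t. \<bar>G t - max 0 t\<bar> \<le> C) \<and>
     continuous_on UNIV b \<and> (\<forall>t. b t \<ge> 0) \<and> (\<forall>t. t \<notin> {0..1} \<longrightarrow> b t = 0) \<and>
     has_bochner_integral lborel b (1::real)"
proof -
  \<comment> \<open>Both flat functions are needed: one glues to 0 at the left end, its mirror image at the right end.\<close>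
  define b0 where "b0 t = flat_exp 1 t * flat_exp 1 (- 1 * t + 1)" for t
  have sm0: "smooth b0" unfolding b0_def
    by (intro smooth_mult smooth_affine smooth_flat_exp)
  have b0_nn: "b0 t \<ge> 0" and b0_supp: "t \<notin> {0..1} \<Longrightarrow> b0 t = 0" for t
    by (auto simp: b0_def flat_exp_def)
  obtain H0 where H0: "H0 0 = 0" "\<And>t. (H0 has_real_derivative b0 t) (at t)"
    using antiderivative_exists smooth_continuous[OF sm0] by blast
  have "H0 0 < H0 1"
  proof (rule DERIV_pos_imp_increasing_open[of 0 1 H0])
    fix t :: real assume "0 < t" "t < 1"
    then show "\<exists>y. (H0 has_real_derivative y) (at t) \<and> 0 < y"
      using H0(2)[of t] by (intro exI[of _ "b0 t"]) (auto simp: b0_def flat_exp_def)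
  qed (use H0(2) in \<open>auto intro: DERIV_atLeastAtMost_imp_continuous_on\<close>)
  then have pos: "H0 1 > 0" using H0(1) by simp
  define b where "b t = inverse (H0 1) * b0 t" for t
  define H where "H t = inverse (H0 1) * H0 t" for t
  have sm: "smooth b" unfolding b_def by (intro smooth_mult smooth_const sm0)
  have b_nn: "b t \<ge> 0" and b_supp: "t \<notin> {0..1} \<Longrightarrow> b t = 0" for t
    using pos b0_nn b0_supp by (auto simp: b_def)
  have H: "(H has_real_derivative b t) (at t)" "H 0 = 0" "H 1 = 1" for t
    using H0 pos unfolding H_def b_def by (auto intro!: derivative_eq_intros)
  have smH: "smooth H" using smooth_antiderivative[OF sm H(1)] .
  obtain G where G: "G 0 = 0" "\<And>t. (G has_real_derivative H t) (at t)"
    using antiderivative_exists smooth_continuous[OF smH] by blast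
  have dG: "deriv G = H" using G(2) DERIV_imp_deriv by blast
  have b0': "b t = 0" if "t \<le> 0 \<or> t \<ge> 1" for t
    using that by (auto simp: b_def b0_def flat_exp_def)
  have H_left: "H t = 0" if "t \<le> 0" for t
    using DERIV_zero_on_convex_const[of H b "{..0}" 0 t] H b0' that by auto
  have H_right: "H t = 1" if "t \<ge> 1" for t
    using DERIV_zero_on_convex_const[of H b "{1..}" 1 t] H b0' that by auto
  have G_left: "G t = 0" if "t \<le> 0" for t
    using DERIV_zero_on_convex_const[of G H "{..0}" 0 t] G H_left that by auto
  have G_right: "G t = t - (1 - G 1)" if "t \<ge> 1" for t
    using DERIV_zero_on_convex_const[of "\<lambda>t. G t - t" "\<lambda>t. H t - 1" "{1..}" 1 t] G H_right that
    by (force intro!: derivative_eq_intros)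
  have "compact (G ` {0..1})"
    using smooth_continuous[OF smooth_antiderivative[OF smH G(2)]] by (intro compact_continuous_image) auto
  then obtain C where C: "\<And>t. t \<in> {0..1} \<Longrightarrow> \<bar>G t\<bar> \<le> C"
    by (metis bounded_iff compact_imp_bounded imageI real_norm_def)
  have bound: "\<bar>G t - max 0 t\<bar> \<le> C + 1" for t
  proof -
    consider "t \<le> 0" | "t \<in> {0..1}" | "t \<ge> 1" by force
    then show ?thesis
    proof cases
      case 1 then show ?thesis using C[of 0] G_left[of t] by auto
    next
      case 2 then show ?thesis using C[of t] by auto
    next
      case 3 then show ?thesis using C[of 1] G_right[of t] by auto
    qed
  qed
  have "has_bochner_integral lborel (\<lambda>t. b t * indicator {0..1} t) (H 1 - H 0)"
    using H(1) smooth_continuous[OF sm, of UNIV]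
    by (intro has_bochner_integral_FTC_Icc_real)
       (auto simp: continuous_on_eq_continuous_at[OF open_UNIV])
  moreover have "(\<lambda>t. b t * indicator {0..1} t) = b"
    using b_supp by (auto simp: indicator_def fun_eq_iff)
  ultimately have "has_bochner_integral lborel b 1" using H by simp
  moreover have "smooth G" using smooth_antiderivative[OF smH G(2)] .
  moreover have "\<forall>t. (deriv G has_real_derivative b t) (at t)" using dG H(1) by blast
  moreover have "\<forall>t\<le>0. G t = 0" "\<forall>t\<ge>1. G t = t - (1 - G 1)" using G_left G_right by blast+
  moreover have "\<forall>t. \<bar>G t - max 0 t\<bar> \<le> C + 1" using bound by blast
  moreover have "continuous_on UNIV b" using smooth_continuous[OF sm] .
  moreover have "\<forall>t. b t \<ge> 0" "\<forall>t. t \<notin> {0..1} \<longrightarrow> b t = 0" using b_nn b_supp by blast+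
  ultimately show ?thesis by metis
qed

text \<open>Rescaling \<open>G\<close> to \<open>e G(t / e)\<close> keeps the slopes, shrinks the distance to the ramp by the factor \<open>e\<close> and
concentrates the second derivative, still of mass 1, near 0: it becomes an approximate delta function.\<close>

lemma scaled_smooth_ramp_exists:
  fixes d :: real
  assumes "d > 0"
  shows "\<exists>R b k. smooth R \<and> (\<forall>t. (deriv R has_real_derivative b t) (at t)) \<and>
     (\<forall>t\<le>0. R t = 0) \<and> (\<forall>t\<ge>d. R t = t - k) \<and> (\<forall>t. \<bar>R t - max 0 t\<bar> \<le> d) \<and>
     continuous_on UNIV b \<and> (\<forall>t. b t \<ge> 0) \<and> (\<forall>t. t \<notin> {0..d} \<longrightarrow> b t = 0) \<and>
     has_bochner_integral lborel b (1::real)"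
proof -
  obtain G b C k where G: "smooth G" "\<And>t. (deriv G has_real_derivative b t) (at t)"
     "\<And>t. t \<le> 0 \<Longrightarrow> G t = 0" "\<And>t. t \<ge> 1 \<Longrightarrow> G t = t - k" "\<And>t. \<bar>G t - max 0 t\<bar> \<le> C"
     and b: "continuous_on UNIV b" "\<And>t. b t \<ge> 0" "\<And>t. t \<notin> {0..1} \<Longrightarrow> b t = 0"
     "has_bochner_integral lborel b (1::real)"
    using smooth_ramp_exists by (elim exE conjE) (rule that, blast+)
  have C: "C \<ge> 0" using G(5)[of 0] by linarith
  define e where "e = d / (C + 1)"
  have e: "e > 0" "e \<le> d" "e * C \<le> d" using C assms by (auto simp: e_def field_simps)
  define R where "R t = e * G (inverse e * t + 0)" for t
  have "smooth R" unfolding R_def by (intro smooth_mult smooth_const smooth_affine G)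
  moreover have dR: "deriv R = (\<lambda>t. deriv G (inverse e * t))"
  proof
    fix t
    have "(R has_real_derivative deriv G (inverse e * t)) (at t)"
      using DERIV_cmult[OF DERIV_chain2[OF smooth_imp_deriv(2)[OF G(1), of "inverse e * t"]
          DERIV_cmult_Id[of "inverse e" t UNIV]], of e] e(1)
      by (simp add: R_def[abs_def] mult.left_commute[of e])
    then show "deriv R t = deriv G (inverse e * t)" by (rule DERIV_imp_deriv)
  qed
  moreover have "(deriv R has_real_derivative inverse e * b (inverse e * t)) (at t)" for t
    using DERIV_chain2[OF G(2)[of "inverse e * t"] DERIV_cmult_Id[of "inverse e" t UNIV]]
    unfolding dR by (simp add: mult.commute)
  moreover have "R t = 0" if "t \<le> 0" for t
    using that e G(3)[of "inverse e * t"] by (simp add: R_def field_simps)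
  moreover have "R t = t - e * k" if "t \<ge> d" for t
    using that e G(4)[of "inverse e * t"] by (simp add: R_def field_simps)
  moreover have "\<bar>R t - max 0 t\<bar> \<le> d" for t
  proof -
    have "max 0 t = e * max 0 (inverse e * t)" using e by (auto simp: max_def field_simps)
    then have "\<bar>R t - max 0 t\<bar> = e * \<bar>G (inverse e * t) - max 0 (inverse e * t)\<bar>"
      using e by (simp add: R_def abs_mult flip: right_diff_distrib)
    also have "\<dots> \<le> e * C" using G(5) e by (intro mult_left_mono) auto
    finally show ?thesis using e by linarith
  qed
  moreover have "continuous_on UNIV (\<lambda>t. inverse e * b (inverse e * t))"
    by (intro continuous_intros continuous_on_compose2[OF b(1)]) auto
  moreover have "inverse e * b (inverse e * t) \<ge> 0" for t using b(2) e by simp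
  moreover have "inverse e * b (inverse e * t) = 0" if "t \<notin> {0..d}" for t
  proof -
    have "inverse e * t \<notin> {0..1}" using that e by (auto simp: field_simps)
    then show ?thesis using b(3) by simp
  qed
  moreover have "has_bochner_integral lborel (\<lambda>t. inverse e * b (inverse e * t)) 1"
  proof -
    have "has_bochner_integral lborel (\<lambda>t. b (0 + inverse e * t)) (1 /\<^sub>R \<bar>inverse e\<bar>)"
      using b(4) e by (subst lborel_has_bochner_integral_real_affine_iff[symmetric]) auto
    from has_bochner_integral_mult_right[OF this, of "inverse e"] show ?thesis
      using e by simp
  qed
  ultimately show ?thesis
    by (intro exI[of _ R] exI[of _ "\<lambda>t. inverse e * b (inverse e * t)"] exI[of _ "e * k"]) blast
qed

section \<open>Second divided differences, hat functions and convexity\<close>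

text \<open>The jump of the slopes of the chords of \<open>f\<close> at \<open>q\<close>, that is, a second divided difference with nodes
\<open>p, q, r\<close>, up to the factor \<open>r - p\<close>.\<close>

definition kink :: "(real \<Rightarrow> real) \<Rightarrow> real \<Rightarrow> real \<Rightarrow> real \<Rightarrow> real" where
  "kink f p q r = (f r - f q) / (r - q) - (f q - f p) / (q - p)"

text \<open>The piecewise linear function with value 1 at \<open>q\<close> and support \<open>[p, r]\<close>. Writing it as the kink of the
ramp \<open>s \<mapsto> max 0 (s - t)\<close> exhibits its second derivative as the functional \<open>kink\<close>, and
makes sums of consecutive hats telescope.\<close>

definition hat :: "real \<Rightarrow> real \<Rightarrow> real \<Rightarrow> real \<Rightarrow> real" where
  "hat p q r t = kink (\<lambda>s. max 0 (s - t)) p q r"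

lemma kink_cong: "f p = g p \<Longrightarrow> f q = g q \<Longrightarrow> f r = g r \<Longrightarrow> kink f p q r = kink g p q r"
  by (simp add: kink_def)

lemma kink_affine: "p < q \<Longrightarrow> q < r \<Longrightarrow> kink (\<lambda>t. u + v * (t - z)) p q r = 0"
proof -
  have "(u + v * (s - z)) - (u + v * (t - z)) = v * (s - t)" for s t by (simp add: algebra_simps)
  then show "p < q \<Longrightarrow> q < r \<Longrightarrow> ?thesis" by (simp add: kink_def)
qed

lemma kink_close:
  assumes "p < q" "q < r" and e: "\<And>s. s \<in> {p, q, r} \<Longrightarrow> \<bar>F s - G s\<bar> \<le> e"
  shows "\<bar>kink F p q r - kink G p q r\<bar> \<le> (2 / (r - q) + 2 / (q - p)) * e"
proof -
  have "\<bar>(F b - G b) - (F a - G a)\<bar> / (b - a) \<le> 2 * e / (b - a)"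
    if "a < b" "a \<in> {p, q, r}" "b \<in> {p, q, r}" for a b
    using e[OF that(2)] e[OF that(3)] that(1) by (intro divide_right_mono) auto
  from this[of q r] this[of p q]
  have "\<bar>((F r - G r) - (F q - G q)) / (r - q)\<bar> \<le> 2 * e / (r - q)"
    "\<bar>((F q - G q) - (F p - G p)) / (q - p)\<bar> \<le> 2 * e / (q - p)"
    using assms by (simp_all add: abs_divide)
  moreover have "kink F p q r - kink G p q r =
      ((F r - G r) - (F q - G q)) / (r - q) - ((F q - G q) - (F p - G p)) / (q - p)"
    by (simp add: kink_def diff_divide_distrib)
  ultimately have "\<bar>kink F p q r - kink G p q r\<bar> \<le> 2 * e / (r - q) + 2 * e / (q - p)"
    by linarith
  then show ?thesis by (simp add: ring_distribs)
qed

lemma hat_eq: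
  assumes "p < q" "q < r"
  shows "hat p q r t = (if t \<le> p then 0 else if t \<le> q then (t - p) / (q - p)
           else if t \<le> r then (r - t) / (r - q) else 0)"
proof -
  have "1 - (q - t) / (q - p) = (t - p) / (q - p)" using assms by (simp add: field_simps)
  moreover have "(q - t - (p - t)) / (q - p) = 1" "(r - t - (q - t)) / (r - q) = 1"
    using assms by simp_all
  ultimately show ?thesis using assms unfolding hat_def kink_def by (simp add: max_def)
qed

lemma hat_bounds:
  assumes "p < q" "q < r"
  shows "0 \<le> hat p q r t" "hat p q r t \<le> 1"
  using assms by (auto simp: hat_eq)

lemma hat_zero: "p < q \<Longrightarrow> q < r \<Longrightarrow> t \<le> p \<or> r \<le> t \<Longrightarrow> hat p q r t = 0"
  by (auto simp: hat_eq)

lemma convex_on_iff_kink_nonneg: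
  fixes f :: "real \<Rightarrow> real"
  shows "convex_on {a..b} f \<longleftrightarrow>
    (\<forall>p q r. a \<le> p \<longrightarrow> p < q \<longrightarrow> q < r \<longrightarrow> r \<le> b \<longrightarrow> kink f p q r \<ge> 0)"
proof (intro iffI allI impI)
  fix p q r assume "convex_on {a..b} f" and pqr: "a \<le> p" "p < q" "q < r" "r \<le> b"
  then have "(f p - f q) / (p - q) \<le> (f p - f r) / (p - r)"
      "(f p - f r) / (p - r) \<le> (f q - f r) / (q - r)"
    using convex_on_slope_le[of "{a..b}" f p r q] by auto
  moreover have "(f p - f q) / (p - q) = (f q - f p) / (q - p)"
    "(f q - f r) / (q - r) = (f r - f q) / (r - q)"
    by (metis minus_diff_eq minus_divide_divide)+
  ultimately show "kink f p q r \<ge> 0" by (simp add: kink_def)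
next
  assume K: "\<forall>p q r. a \<le> p \<longrightarrow> p < q \<longrightarrow> q < r \<longrightarrow> r \<le> b \<longrightarrow> kink f p q r \<ge> 0"
  show "convex_on {a..b} f"
  proof (rule convex_on_linorderI)
    fix t x y :: real
    assume t: "t > 0" "t < 1" and xy: "x \<in> {a..b}" "y \<in> {a..b}" "x < y"
    define z where "z = (1 - t) *\<^sub>R x + t *\<^sub>R y"
    have dist1: "z - x = t * (y - x)" unfolding z_def by (simp add: algebra_simps)
    have dist2: "y - z = (1 - t) * (y - x)" unfolding z_def by (simp add: algebra_simps)
    have "0 < z - x" "0 < y - z" using t xy by (simp_all add: dist1 dist2)
    then have "kink f x z y \<ge> 0" using K xy by simp
    then have "(f z - f x) / (z - x) \<le> (f y - f z) / (y - z)" by (simp add: kink_def)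
    then have "(f z - f x) / (t * (y - x)) \<le> (f y - f z) / ((1 - t) * (y - x))"
      by (simp only: dist1 dist2)
    then have "(f z - f x) / t \<le> (f y - f z) / (1 - t)"
      using xy t by (simp add: divide_simps mult_ac split: if_splits)
    then have "f z \<le> (1 - t) * f x + t * f y"
      using t by (simp add: field_simps)
    then show "f ((1 - t) *\<^sub>R x + t *\<^sub>R y) \<le> (1 - t) * f x + t * f y"
      by (simp only: z_def)
  qed simp
qed

text \<open>The factors 1 and - 1 allow convexity and concavity to be treated alike, as the cases of a sign
\<open>\<tau>\<close> with \<open>\<tau> * kink f p q r \<ge> 0\<close>.\<close>

lemma convex_on_iff_signed_kink:
  shows "convex_on {b..c} f \<longleftrightarrow> (\<forall>p q r. b \<le> p \<longrightarrow> p < q \<longrightarrow> q < r \<longrightarrow> r \<le> c \<longrightarrow> 1 * kink f p q r \<ge> 0)"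
    and "concave_on {b..c} f \<longleftrightarrow>
      (\<forall>p q r. b \<le> p \<longrightarrow> p < q \<longrightarrow> q < r \<longrightarrow> r \<le> c \<longrightarrow> - 1 * kink f p q r \<ge> 0)"
proof -
  have "kink (\<lambda>t. - f t) p q r = - kink f p q r" for p q r
    by (simp add: kink_def diff_divide_distrib)
  then show "concave_on {b..c} f \<longleftrightarrow>
      (\<forall>p q r. b \<le> p \<longrightarrow> p < q \<longrightarrow> q < r \<longrightarrow> r \<le> c \<longrightarrow> - 1 * kink f p q r \<ge> 0)"
    unfolding concave_on_def convex_on_iff_kink_nonneg by simp
  show "convex_on {b..c} f \<longleftrightarrow> (\<forall>p q r. b \<le> p \<longrightarrow> p < q \<longrightarrow> q < r \<longrightarrow> r \<le> c \<longrightarrow> 1 * kink f p q r \<ge> 0)"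
    unfolding convex_on_iff_kink_nonneg by simp
qed

lemma concave_on_min:
  assumes "concave_on S f" "concave_on S g"
  shows "concave_on S (\<lambda>t. min (f t) (g t))"
  unfolding concave_on_iff
proof (intro conjI ballI allI impI)
  show "convex S" using assms(1) by (simp add: concave_on_iff)
  fix a b u v assume *: "a \<in> S" "b \<in> S" "u \<ge> (0::real)" "v \<ge> 0" "u + v = 1"
  have "u * min (f a) (g a) + v * min (f b) (g b) \<le> u * f a + v * f b"
    using * by (intro add_mono mult_left_mono) auto
  moreover have "u * min (f a) (g a) + v * min (f b) (g b) \<le> u * g a + v * g b"
    using * by (intro add_mono mult_left_mono) auto
  ultimately show "u * min (f a) (g a) + v * min (f b) (g b)
      \<le> min (f (u *\<^sub>R a + v *\<^sub>R b)) (g (u *\<^sub>R a + v *\<^sub>R b))"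
    using assms * unfolding concave_on_iff by (meson min.boundedI order_trans)
qed

lemma concave_on_affine:
  fixes u v :: real
  shows "convex S \<Longrightarrow> concave_on S (\<lambda>t. u + v * t)"
  unfolding concave_on_iff
proof (intro conjI ballI allI impI)
  fix a b s t :: real assume st: "s + t = 1"
  have "s * (u + v * a) + t * (u + v * b) = (s + t) * u + v * (s * a + t * b)"
    by (simp add: algebra_simps)
  then show "s * (u + v * a) + t * (u + v * b) \<le> u + v * (s *\<^sub>R a + t *\<^sub>R b)"
    using st by simp
qed

lemma concave_on_transfer:
  fixes S :: "real set"
  assumes "concave_on S g" "\<And>t. t \<in> S \<Longrightarrow> f t = g t"
  shows "concave_on S f"
  unfolding concave_on_iff
proof (intro conjI ballI allI impI)
  show S: "convex S" using assms(1) by (simp add: concave_on_iff)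
  fix b c u v assume *: "b \<in> S" "c \<in> S" "u \<ge> (0::real)" "v \<ge> 0" "u + v = 1"
  then have "u *\<^sub>R b + v *\<^sub>R c \<in> S" using convexD[OF S] by blast
  then show "u * f b + v * f c \<le> f (u *\<^sub>R b + v *\<^sub>R c)"
    using assms * unfolding concave_on_iff by simp
qed

text \<open>On \<open>[p, q]\<close> and on \<open>[q, r]\<close> the left-hand side is affine, and at \<open>p, q, r\<close> it does not exceed the concave
function \<open>1 + h \<ge> 0\<close>.\<close>

lemma concave_ge_hat:
  assumes pqr: "p < q" "q < r" and conc: "concave_on {p..r} h" and h: "\<And>t. h t \<ge> - 1"
  shows "(1 + h q) * hat p q r t \<le> 1 + h t"
proof -
  consider "t \<le> p \<or> r \<le> t" | "p < t" "t \<le> q" | "q < t" "t < r" by linarith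
  then show ?thesis
  proof cases
    case 1 then show ?thesis using hat_zero[OF pqr] h[of t] by auto
  next
    case 2
    define s where "s = (t - p) / (q - p)"
    have "s * (q - p) = t - p" using pqr by (simp add: s_def)
    then have "t = (1 - s) * p + s * q" by (simp add: algebra_simps)
    moreover have "0 \<le> s" "s \<le> 1" using 2 pqr by (auto simp: s_def field_simps)
    ultimately have s: "0 \<le> s" "s \<le> 1" "t = (1 - s) * p + s * q" by auto
    have "concave_on {p..q} h" using conc pqr by (auto simp: concave_on_def intro: convex_on_subset)
    then have "(1 - s) * h p + s * h q \<le> h t"
      using concave_onD_Icc[of p q h s] s pqr by simp
    moreover have "(1 - s) * - 1 \<le> (1 - s) * h p" using h[of p] s by (intro mult_left_mono) auto
    moreover have "hat p q r t = s" using 2 pqr by (simp add: hat_eq s_def)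
    ultimately show ?thesis by (simp add: algebra_simps)
  next
    case 3
    define s where "s = (r - t) / (r - q)"
    have "s * (r - q) = r - t" using pqr by (simp add: s_def)
    then have "t = (1 - (1 - s)) * q + (1 - s) * r" by (simp add: algebra_simps)
    moreover have "0 \<le> s" "s \<le> 1" using 3 pqr by (auto simp: s_def field_simps)
    ultimately have s: "0 \<le> s" "s \<le> 1" "t = (1 - (1 - s)) * q + (1 - s) * r" by auto
    have "concave_on {q..r} h" using conc pqr by (auto simp: concave_on_def intro: convex_on_subset)
    then have "s * h q + (1 - s) * h r \<le> h t"
      using concave_onD_Icc[of q r h "1 - s"] s pqr by simp
    moreover have "(1 - s) * - 1 \<le> (1 - s) * h r" using h[of r] s by (intro mult_left_mono) auto
    moreover have "hat p q r t = s" using 3 pqr by (simp add: hat_eq s_def)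
    ultimately show ?thesis by (simp add: algebra_simps)
  qed
qed

lemma segment_coordinate:
  fixes a b t :: real
  assumes "a < b" "t \<in> {a..b}"
  obtains l where "0 \<le> l" "l \<le> 1" "t = a + l * (b - a)" "a < t \<Longrightarrow> 0 < l" "t < b \<Longrightarrow> l < 1"
proof
  show "0 \<le> (t - a) / (b - a)" "(t - a) / (b - a) \<le> 1" "t = a + (t - a) / (b - a) * (b - a)"
    "a < t \<Longrightarrow> 0 < (t - a) / (b - a)" "t < b \<Longrightarrow> (t - a) / (b - a) < 1"
    using assms by (simp_all add: divide_le_eq)
qed

section \<open>Functions vanishing at infinity, test functions and measures\<close>

lemma C0_bounded:
  assumes "g \<in> C0"
  shows "\<exists>B. \<forall>t. \<bar>g t\<bar> \<le> B"
proof -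
  have "\<forall>\<^sub>F t in at_top. \<bar>g t\<bar> < 1" "\<forall>\<^sub>F t in at_bot. \<bar>g t\<bar> < 1"
    using assms order_tendstoD(2)[OF tendsto_rabs_zero, of g _ 1] by (auto simp: C0_def)
  then obtain u l where u: "\<And>t. t \<ge> u \<Longrightarrow> \<bar>g t\<bar> < 1" and l: "\<And>t. t \<le> l \<Longrightarrow> \<bar>g t\<bar> < 1"
    by (auto simp: eventually_at_top_linorder eventually_at_bot_linorder)
  have "compact (g ` {l..u})"
    using assms by (intro compact_continuous_image) (auto simp: C0_def intro: continuous_on_subset)
  then obtain B where B: "\<And>t. t \<in> {l..u} \<Longrightarrow> \<bar>g t\<bar> \<le> B"
    by (metis bounded_iff compact_imp_bounded imageI real_norm_def)
  have "\<bar>g t\<bar> \<le> max B 1" for t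
    using B[of t] u[of t] l[of t] by fastforce
  then show ?thesis by blast
qed

lemma abs_le_sup_norm:
  assumes "g \<in> C0"
  shows "\<bar>g t\<bar> \<le> sup_norm g"
  unfolding sup_norm_def
  using C0_bounded[OF assms] by (intro cSUP_upper) (auto simp: bdd_above_def)

lemma sup_norm_le: "(\<And>t. \<bar>g t\<bar> \<le> K) \<Longrightarrow> sup_norm g \<le> K"
  unfolding sup_norm_def by (rule cSUP_least) auto

lemma C0_zero: "(\<lambda>t. 0) \<in> C0"
  and C0_add: "g \<in> C0 \<Longrightarrow> h \<in> C0 \<Longrightarrow> (\<lambda>t. g t + h t) \<in> C0"
  and C0_cmult: "g \<in> C0 \<Longrightarrow> (\<lambda>t. c * g t) \<in> C0"
  by (auto simp: C0_def intro!: continuous_intros tendsto_add_zero tendsto_mult_right_zero)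

lemma C0_diff: "g \<in> C0 \<Longrightarrow> h \<in> C0 \<Longrightarrow> (\<lambda>t. g t - h t) \<in> C0"
  using C0_add[of g "\<lambda>t. - 1 * h t"] C0_cmult[of h "- 1"] by simp

lemma C0_sum:
  assumes "\<And>i. i \<in> I \<Longrightarrow> g i \<in> C0"
  shows "(\<lambda>t. \<Sum>i\<in>I. c i * g i t) \<in> C0"
  using assms
proof (induction I rule: infinite_finite_induct)
  case (insert i I)
  then show ?case using C0_add[OF C0_cmult[of "g i" "c i"], of "\<lambda>t. \<Sum>i\<in>I. c i * g i t"] by simp
qed (simp_all add: C0_zero)

lemma compactly_supported_C0:
  assumes "continuous_on UNIV g" "\<And>t. t \<notin> {a..b} \<Longrightarrow> g t = 0"
  shows "g \<in> C0"
proof -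
  have "\<forall>\<^sub>F t in at_top. g t = 0"
    using assms(2) by (intro eventually_mono[OF eventually_gt_at_top[of b]]) auto
  moreover have "\<forall>\<^sub>F t in at_bot. g t = 0"
    using assms(2) by (intro eventually_mono[OF eventually_gt_at_bot[of a]]) auto
  ultimately show ?thesis using assms(1) by (auto simp: C0_def intro: tendsto_eventually)
qed

lemma hat_C0:
  assumes "p < q" "q < r"
  shows "hat p q r \<in> C0"
proof (rule compactly_supported_C0[of _ p r])
  show "continuous_on UNIV (hat p q r)"
    unfolding hat_def[abs_def] kink_def using assms by (intro continuous_intros) auto
qed (use assms in \<open>auto simp: hat_eq\<close>)

lemma Schwartz_bounds:
  assumes "\<phi> \<in> Schwartz"
  shows "\<exists>B. \<forall>t. \<bar>t ^ k * (deriv ^^ n) \<phi> t\<bar> \<le> B"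
  using assms unfolding Schwartz_def bounded_iff by auto

lemma Schwartz_has_derivative:
  assumes "\<phi> \<in> Schwartz"
  shows "((deriv ^^ n) \<phi> has_real_derivative (deriv ^^ Suc n) \<phi> t) (at t)"
  using assms unfolding Schwartz_def by (simp add: field_differentiable_derivI)

lemma Schwartz_continuous:
  assumes "\<phi> \<in> Schwartz"
  shows "continuous_on A ((deriv ^^ n) \<phi>)"
  using Schwartz_has_derivative[OF assms]
  by (meson DERIV_continuous_on has_field_derivative_at_within)

text \<open>The function times one further power of \<open>t\<close> is still bounded.\<close>

lemma Schwartz_tendsto_0:
  assumes "\<phi> \<in> Schwartz" "F \<le> at_infinity"
  shows "((\<lambda>t. t ^ k * (deriv ^^ n) \<phi> t) \<longlongrightarrow> 0) F"
proof -
  obtain B where B: "\<And>t. \<bar>t ^ Suc k * (deriv ^^ n) \<phi> t\<bar> \<le> B"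
    using Schwartz_bounds[OF assms(1), of "Suc k" n] by blast
  have "((\<lambda>t. B / t) \<longlongrightarrow> 0) at_infinity"
    by (intro tendsto_divide_0[OF tendsto_const] filterlim_ident)
  then have lim: "((\<lambda>t. \<bar>B / t\<bar>) \<longlongrightarrow> 0) at_infinity" by (rule tendsto_rabs_zero)
  have "\<forall>\<^sub>F t in at_infinity. norm (t ^ k * (deriv ^^ n) \<phi> t) \<le> \<bar>B / t\<bar>"
    unfolding eventually_at_infinity
  proof (intro exI[of _ 1] allI impI)
    fix t :: real assume "1 \<le> norm t"
    then show "norm (t ^ k * (deriv ^^ n) \<phi> t) \<le> \<bar>B / t\<bar>"
      using B[of t] by (simp add: abs_mult field_simps)
  qed
  then show ?thesis
    by (intro tendsto_mono[OF assms(2)] Lim_null_comparison[OF _ lim])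
qed

lemma Schwartz_deriv:
  assumes "\<phi> \<in> Schwartz"
  shows "deriv \<phi> \<in> Schwartz"
proof -
  have "(deriv ^^ n) (deriv \<phi>) = (deriv ^^ Suc n) \<phi>" for n
    by (simp add: funpow_swap1)
  then show ?thesis using assms unfolding Schwartz_def by (simp only: mem_Collect_eq) blast
qed

lemma Schwartz_subset_C0: "Schwartz \<subseteq> C0"
proof
  fix \<phi> :: "real \<Rightarrow> real" assume "\<phi> \<in> Schwartz"
  then show "\<phi> \<in> C0"
    using Schwartz_continuous[of \<phi> UNIV 0] Schwartz_tendsto_0[of \<phi> at_top 0 0]
      Schwartz_tendsto_0[of \<phi> at_bot 0 0] at_top_le_at_infinity at_bot_le_at_infinity
    by (simp add: C0_def)
qed

lemma Radon_add: "w \<in> Radon_measures \<Longrightarrow> g \<in> C0 \<Longrightarrow> h \<in> C0 \<Longrightarrow> w (\<lambda>t. g t + h t) = w g + w h"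
  and Radon_cmult: "w \<in> Radon_measures \<Longrightarrow> g \<in> C0 \<Longrightarrow> w (\<lambda>t. c * g t) = c * w g"
  by (auto simp: Radon_measures_def)

lemma Radon_diff:
  "w \<in> Radon_measures \<Longrightarrow> g \<in> C0 \<Longrightarrow> h \<in> C0 \<Longrightarrow> w (\<lambda>t. g t - h t) = w g - w h"
  using Radon_add[of w g "\<lambda>t. - 1 * h t"] Radon_cmult[of w h "- 1"] C0_cmult[of h "- 1"] by simp

lemma Radon_sum:
  assumes "w \<in> Radon_measures" "finite I" "\<And>i. i \<in> I \<Longrightarrow> g i \<in> C0"
  shows "w (\<lambda>t. \<Sum>i\<in>I. c i * g i t) = (\<Sum>i\<in>I. c i * w (g i))"
  using assms(2,3)
proof (induction I)
  case empty
  show ?case using Radon_cmult[OF assms(1) C0_zero, of 0] by simp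
next
  case (insert i I)
  then show ?case
    using Radon_add[OF assms(1) C0_cmult[of "g i" "c i"] C0_sum[of I g c]]
      Radon_cmult[OF assms(1), of "g i" "c i"]
    by simp
qed

lemma Radon_bounded:
  assumes "w \<in> Radon_measures"
  shows "\<exists>B\<ge>0. \<forall>g\<in>C0. \<forall>K. (\<forall>t. \<bar>g t\<bar> \<le> K) \<longrightarrow> \<bar>w g\<bar> \<le> B * K"
proof -
  obtain B where B: "\<And>g. g \<in> C0 \<Longrightarrow> \<bar>w g\<bar> \<le> B * sup_norm g"
    using assms unfolding Radon_measures_def by blast
  have "\<bar>w g\<bar> \<le> \<bar>B\<bar> * K" if "g \<in> C0" "\<forall>t. \<bar>g t\<bar> \<le> K" for g K
  proof -
    have "0 \<le> sup_norm g" using abs_le_sup_norm[OF that(1), of 0] by linarith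
    then have "B * sup_norm g \<le> \<bar>B\<bar> * K"
      using that(2) by (intro mult_mono sup_norm_le) auto
    then show ?thesis using B[OF that(1)] by linarith
  qed
  then show ?thesis by (intro exI[of _ "\<bar>B\<bar>"]) auto
qed

section \<open>The second derivative of a function on hat functions\<close>

lemma eq_zero_if_le_multiples:
  fixes a K :: real
  assumes "\<And>e. e > 0 \<Longrightarrow> \<bar>a\<bar> \<le> K * e"
  shows "a = 0"
proof (rule ccontr)
  assume "a \<noteq> 0"
  define e where "e = \<bar>a\<bar> / (2 * (\<bar>K\<bar> + 1))"
  have e: "e > 0" "(\<bar>K\<bar> + 1) * e = \<bar>a\<bar> / 2" using \<open>a \<noteq> 0\<close> by (simp_all add: e_def field_simps)
  have "K * e \<le> (\<bar>K\<bar> + 1) * e" using e(1) by (intro mult_right_mono) auto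
  then show False using assms[OF e(1)] e(2) \<open>a \<noteq> 0\<close> by linarith
qed

lemma integrable_compactly_supported:
  fixes h :: "real \<Rightarrow> real"
  assumes "continuous_on UNIV h" "\<And>t. t \<notin> {a..c} \<Longrightarrow> h t = 0"
  shows "integrable lborel h"
proof -
  have "integrable lborel (\<lambda>t. indicator {a..c} t *\<^sub>R h t)"
    using assms(1) by (intro borel_integrable_compact) (auto intro: continuous_on_subset)
  moreover have "(\<lambda>t. indicator {a..c} t *\<^sub>R h t) = h"
    using assms(2) by (auto simp: indicator_def fun_eq_iff)
  ultimately show ?thesis by simp
qed

text \<open>The weight \<open>b (s - t)\<close> has mass 1 and lives where \<open>f\<close> differs from \<open>f s\<close> by at most \<open>e\<close>.\<close>

lemma integral_against_approximate_delta:
  fixes f b :: "real \<Rightarrow> real"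
  assumes f: "continuous_on UNIV f" and b: "continuous_on UNIV b" "\<And>t. b t \<ge> 0"
    "\<And>t. t \<notin> {0..d} \<Longrightarrow> b t = 0" "has_bochner_integral lborel b 1"
    and e: "\<And>t. t \<in> {s - d..s} \<Longrightarrow> \<bar>f t - f s\<bar> \<le> e"
  shows "integrable lborel (\<lambda>t. f t * b (s - t))"
    and "\<bar>(LINT t|lborel. f t * b (s - t)) - f s\<bar> \<le> e"
proof -
  have cont_b: "continuous_on UNIV (\<lambda>t. b (s - t))"
    by (intro continuous_on_compose2[OF b(1)] continuous_intros) auto
  have b0: "b (s - t) = 0" if "t \<notin> {s - d..s}" for t
    using that by (intro b(3)) auto
  show int: "integrable lborel (\<lambda>t. f t * b (s - t))"
    by (rule integrable_compactly_supported[of _ "s - d" s])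
       (intro continuous_intros f cont_b, simp add: b0)
  have "has_bochner_integral lborel (\<lambda>t. b (s + (- 1) * t)) (1 /\<^sub>R \<bar>- 1\<bar>)"
    using b(4) by (subst lborel_has_bochner_integral_real_affine_iff[symmetric]) auto
  then have one: "has_bochner_integral lborel (\<lambda>t. b (s - t)) 1" by simp
  have int1: "integrable lborel (\<lambda>t. (f t - f s) * b (s - t))"
    by (rule integrable_compactly_supported[of _ "s - d" s])
       (intro continuous_intros f cont_b, simp add: b0)
  have "(LINT t|lborel. f t * b (s - t)) - f s
      = (LINT t|lborel. f t * b (s - t)) - (LINT t|lborel. f s * b (s - t))"
    using one by (simp add: has_bochner_integral_iff)
  also have "\<dots> = (LINT t|lborel. (f t - f s) * b (s - t))"
    using int one by (subst Bochner_Integration.integral_diff[symmetric])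
      (auto simp: has_bochner_integral_iff left_diff_distrib)
  also have "\<bar>\<dots>\<bar> \<le> (LINT t|lborel. e * b (s - t))"
  proof (rule integral_abs_bound_integral)
    fix t
    show "\<bar>(f t - f s) * b (s - t)\<bar> \<le> e * b (s - t)"
      using e[of t] b0[of t] b(2)[of "s - t"]
      by (cases "t \<in> {s - d..s}") (auto simp: abs_mult intro: mult_right_mono)
  qed (use int1 one in \<open>auto simp: has_bochner_integral_iff\<close>)
  also have "\<dots> = e" using one by (simp add: has_bochner_integral_iff)
  finally show "\<bar>(LINT t|lborel. f t * b (s - t)) - f s\<bar> \<le> e" .
qed

lemma smooth_kink: "(\<And>s. smooth (F s)) \<Longrightarrow> smooth (\<lambda>t. kink (\<lambda>s. F s t) p q r)"
  unfolding kink_def divide_inverse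
  by (intro smooth_diff smooth_mult smooth_const)

lemma DERIV_kink:
  "(\<And>s. (F s has_real_derivative F' s) (at t)) \<Longrightarrow>
   ((\<lambda>t. kink (\<lambda>s. F s t) p q r) has_real_derivative kink F' p q r) (at t)"
  unfolding kink_def by (intro DERIV_diff DERIV_cdivide)

text \<open>Formally, the second derivative of the hat function is a combination of delta functions at \<open>p, q, r\<close>
with the coefficients of \<open>kink\<close>, so moving both derivatives of \<open>w = f''\<close> onto the hat gives the claim. The
rigorous version tests with the smooth functions obtained from smooth ramps, which converge uniformly to
the hat; boundedness of \<open>w\<close> and continuity of \<open>f\<close> control the two errors.\<close>

lemma D2_hat:
  assumes rep: "represents_D2 w f" and f: "continuous_on UNIV f" and pqr: "p < q" "q < r"
  shows "w (hat p q r) = kink f p q r"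
proof -
  have wR: "w \<in> Radon_measures" using rep by (simp add: represents_D2_def)
  obtain B where B: "B \<ge> 0" "\<And>g K. g \<in> C0 \<Longrightarrow> (\<forall>t. \<bar>g t\<bar> \<le> K) \<Longrightarrow> \<bar>w g\<bar> \<le> B * K"
    using Radon_bounded[OF wR] by blast
  let ?D = "2 / (r - q) + 2 / (q - p)"
  have "\<bar>w (hat p q r) - kink f p q r\<bar> \<le> (B * ?D + ?D) * e" if e: "e > 0" for e
  proof -
    have "\<exists>d>0. \<forall>t. \<bar>t - s\<bar> \<le> d \<longrightarrow> \<bar>f t - f s\<bar> \<le> e" for s
    proof -
      have "isCont f s" using f by (simp add: continuous_on_eq_continuous_at)
      then obtain d where "d > 0" "\<And>t. \<bar>t - s\<bar> < d \<Longrightarrow> \<bar>f t - f s\<bar> < e"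
        using e unfolding continuous_at_eps_delta dist_real_def by blast
      then show ?thesis by (intro exI[of _ "d / 2"]) (auto intro: less_imp_le)
    qed
    then obtain D where D: "\<And>s. D s > 0" "\<And>s t. \<bar>t - s\<bar> \<le> D s \<Longrightarrow> \<bar>f t - f s\<bar> \<le> e"
      by metis
    \<comment> \<open>One \<open>d\<close> controls both errors: the oscillation of \<open>f\<close> and the distance from \<open>\<phi>\<close> to the hat.\<close>
    define d where "d = min e (min (D p) (min (D q) (D r)))"
    have d: "d > 0" "d \<le> e" "\<And>s t. s \<in> {p, q, r} \<Longrightarrow> t \<in> {s - d..s} \<Longrightarrow> \<bar>f t - f s\<bar> \<le> e"
      using D e by (auto simp: d_def)
    obtain R b k where R: "smooth R" "\<And>t. (deriv R has_real_derivative b t) (at t)"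
      "\<And>t. t \<le> 0 \<Longrightarrow> R t = 0" "\<And>t. t \<ge> d \<Longrightarrow> R t = t - k" "\<And>t. \<bar>R t - max 0 t\<bar> \<le> d"
      and b: "continuous_on UNIV b" "\<And>t. b t \<ge> 0" "\<And>t. t \<notin> {0..d} \<Longrightarrow> b t = 0"
      "has_bochner_integral lborel b (1::real)"
      using scaled_smooth_ramp_exists[OF d(1)] by (elim exE conjE) (rule that, blast+)
    \<comment> \<open>Replacing the ramp by its smooth version turns the hat into a test function whose second
      derivative is the same combination of approximate delta functions.\<close>
    define \<phi> where "\<phi> t = kink (\<lambda>s. R (s - t)) p q r" for t
    have "smooth (\<lambda>t. kink (\<lambda>s. R (- 1 * t + s)) p q r)"
      by (intro smooth_kink smooth_affine R)
    then have smooth: "smooth \<phi>" by (simp add: \<phi>_def[abs_def])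
    have "\<phi> t = 0" if "t \<notin> {p - d..r}" for t
    proof (cases "t < p - d")
      case True
      then have "\<phi> t = kink (\<lambda>s. s - t - k) p q r"
        using pqr d(1) by (simp add: \<phi>_def kink_def R(4))
      then show ?thesis using pqr by (simp add: kink_def)
    next
      case False
      then show ?thesis using that pqr by (simp add: \<phi>_def kink_def R(3))
    qed
    then have S: "\<phi> \<in> Schwartz" by (rule compactly_supported_smooth_Schwartz[OF smooth])
    have d1: "deriv \<phi> = (\<lambda>t. kink (\<lambda>s. deriv R (s - t) * - 1) p q r)"
    proof
      fix t
      have "((\<lambda>t. R (s - t)) has_real_derivative deriv R (s - t) * - 1) (at t)" for s
        by (rule DERIV_chain2[OF smooth_imp_deriv(2)[OF R(1)]]) (auto intro!: derivative_eq_intros)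
      from DERIV_kink[OF this] show "deriv \<phi> t = kink (\<lambda>s. deriv R (s - t) * - 1) p q r"
        unfolding \<phi>_def by (rule DERIV_imp_deriv)
    qed
    have d2: "deriv (deriv \<phi>) = (\<lambda>t. kink (\<lambda>s. b (s - t)) p q r)"
    proof
      fix t
      have "((\<lambda>t. deriv R (s - t)) has_real_derivative b (s - t) * - 1) (at t)" for s
        by (rule DERIV_chain2[OF R(2)]) (auto intro!: derivative_eq_intros)
      then have "((\<lambda>t. deriv R (s - t) * - 1) has_real_derivative b (s - t)) (at t)" for s
        using DERIV_cmult_right[of "\<lambda>t. deriv R (s - t)" "b (s - t) * - 1" t UNIV "- 1"] by simp
      from DERIV_kink[OF this]
      show "deriv (deriv \<phi>) t = kink (\<lambda>s. b (s - t)) p q r"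
        unfolding d1 by (rule DERIV_imp_deriv)
    qed
    have int: "integrable lborel (\<lambda>t. f t * b (s - t))"
      and close: "\<bar>(LINT t|lborel. f t * b (s - t)) - f s\<bar> \<le> e" if "s \<in> {p, q, r}" for s
      using integral_against_approximate_delta[OF f b d(3)[OF that]] by blast+
    have "w \<phi> = (LINT t|lborel. f t * deriv (deriv \<phi>) t)"
      using rep S by (simp add: represents_D2_def distr_deriv_def distr_of_def)
    also have "\<dots> = (LINT t|lborel. kink (\<lambda>s. f t * b (s - t)) p q r)"
      unfolding d2 by (intro Bochner_Integration.integral_cong refl) (simp add: kink_def algebra_simps diff_divide_distrib)
    also have "\<dots> = kink (\<lambda>s. LINT t|lborel. f t * b (s - t)) p q r"
      using int unfolding kink_def by simp
    finally have "\<bar>w \<phi> - kink f p q r\<bar> \<le> ?D * e"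
      using kink_close[OF pqr, of "\<lambda>s. LINT t|lborel. f t * b (s - t)" f e] close by auto
    moreover have "\<bar>w (\<lambda>t. hat p q r t - \<phi> t)\<bar> \<le> B * (?D * e)"
    proof (rule B(2))
      show "(\<lambda>t. hat p q r t - \<phi> t) \<in> C0"
        using C0_diff[OF hat_C0[OF pqr]] Schwartz_subset_C0 S by blast
      have "\<bar>max 0 (s - t) - R (s - t)\<bar> \<le> e" for s t
        using R(5)[of "s - t"] d(2) by linarith
      then show "\<forall>t. \<bar>hat p q r t - \<phi> t\<bar> \<le> ?D * e"
        unfolding hat_def \<phi>_def by (intro allI kink_close[OF pqr]) simp
    qed
    moreover have "w (\<lambda>t. hat p q r t - \<phi> t) = w (hat p q r) - w \<phi>"
      using Radon_diff[OF wR hat_C0[OF pqr]] Schwartz_subset_C0 S by blast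
    ultimately show ?thesis by (simp add: algebra_simps)
  qed
  then have "w (hat p q r) - kink f p q r = 0" by (rule eq_zero_if_le_multiples)
  then show ?thesis by simp
qed

section \<open>Approximation by hat functions\<close>

lemma finite_set_increasing_enumeration:
  fixes P :: "real set"
  assumes "finite P" "a \<in> P" "b \<in> P" "a < b"
  shows "\<exists>n p. P = p ` {..Suc n} \<and> (\<forall>i\<le>n. p i < p (Suc i)) \<and>
           (\<forall>i\<le>n. P \<inter> {p i<..<p (Suc i)} = {})"
proof -
  define xs where "xs = sorted_list_of_set P"
  have xs: "set xs = P" "sorted_wrt (<) xs" using assms by (simp_all add: xs_def)
  have "card {a, b} \<le> card P" using assms by (intro card_mono) auto
  then have len: "length xs \<ge> 2" using assms by (simp add: xs_def)
  define n where "n = length xs - 2"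
  have n: "length xs = Suc (Suc n)" using len by (simp add: n_def)
  have less: "xs ! i < xs ! j" if "i < j" "j \<le> Suc n" for i j
    using sorted_wrt_nth_less[OF xs(2)] that n by simp
  have P: "P = (\<lambda>i. xs ! i) ` {..Suc n}"
    using xs(1) n by (auto simp: set_conv_nth image_iff less_Suc_eq_le)
  moreover have "\<forall>i\<le>n. xs ! i < xs ! Suc i" using less by simp
  moreover have "P \<inter> {xs ! i<..<xs ! Suc i} = {}" if "i \<le> n" for i
  proof -
    have False if "j \<le> Suc n" "xs ! i < xs ! j" "xs ! j < xs ! Suc i" for j
      using less[of j i] less[of "Suc i" j] that \<open>i \<le> n\<close>
      by (cases j i rule: linorder_cases; cases "j = Suc i") auto
    then show ?thesis unfolding P by auto
  qed
  ultimately show ?thesis by (intro exI[of _ n] exI[of _ "\<lambda>i. xs ! i"]) blast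
qed

text \<open>The union of \<open>X\<close> with a fine equidistant grid, listed in increasing order.\<close>

lemma fine_grid_exists:
  fixes X :: "real set" and L d :: real
  assumes "finite X" "X \<subseteq> {- L..L}" "L > 0" "d > 0"
  shows "\<exists>n p. (\<forall>i\<le>n. p i < p (Suc i) \<and> X \<inter> {p i<..<p (Suc i)} = {} \<and> p (Suc i) - p i \<le> d) \<and>
     p 0 = - L \<and> p (Suc n) = L \<and> (\<forall>i\<le>Suc n. p i \<in> {- L..L})"
proof -
  obtain N0 :: nat where N0: "2 * L / d < real N0" using reals_Archimedean2 by blast
  \<comment> \<open>An equidistant grid whose last node is exactly \<open>L\<close>; its spacing bounds all gaps of a finer set.\<close>
  define N where "N = Suc N0"
  define h where "h = 2 * L / real N"
  have h: "h > 0" "h \<le> d" "real N * h = 2 * L"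
    using N0 assms by (simp_all add: h_def N_def field_simps)
  define z where "z k = - L + real k * h" for k
  define P where "P = X \<union> z ` {..N}"
  have z: "z 0 = - L" "z N = L" using h by (auto simp: z_def)
  have z_in: "z k \<in> {- L..L}" if "k \<le> N" for k
  proof -
    have "real k * h \<le> real N * h" using that h by (intro mult_right_mono) auto
    then show ?thesis using h by (simp add: z_def)
  qed
  have P: "finite P" "- L \<in> P" "L \<in> P" "P \<subseteq> {- L..L}"
    using assms z z_in unfolding P_def by (auto intro: image_eqI[of _ z 0] image_eqI[of _ z N])
  obtain n p where p: "P = p ` {..Suc n}" "\<And>i. i \<le> n \<Longrightarrow> p i < p (Suc i)"
    "\<And>i. i \<le> n \<Longrightarrow> P \<inter> {p i<..<p (Suc i)} = {}"
    using finite_set_increasing_enumeration[OF P(1-3)] \<open>L > 0\<close> by auto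
  have mono: "p i \<le> p j" if "i \<le> j" "j \<le> Suc n" for i j
    using that
  proof (induction j rule: dec_induct)
    case (step j)
    then show ?case using p(2)[of j] by simp
  qed simp
  have in_P: "p i \<in> P" if "i \<le> Suc n" for i using p(1) that by blast
  have "p (Suc i) - p i \<le> d" if "i \<le> n" for i
  proof -
    have pi: "- L \<le> p i" "p i < L"
      using in_P[of i] in_P[of "Suc i"] p(2)[OF that] that P(4) by fastforce+
    \<comment> \<open>\<open>z (k + 1)\<close> is the first equidistant node to the right of \<open>p i\<close>, so the next node comes no later.\<close>
    define k where "k = nat \<lfloor>(p i + L) / h\<rfloor>"
    have "real k \<le> (p i + L) / h" "(p i + L) / h < real k + 1"
      using pi h unfolding k_def by auto
    then have k: "real k * h \<le> p i + L" "p i + L < real (Suc k) * h"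
      using h by (simp_all add: field_simps)
    then have "real k * h < real N * h" using pi h by linarith
    then have "real k < real N" using h(1) mult_less_cancel_right_pos by blast
    then have "Suc k \<le> N" by simp
    then have "z (Suc k) \<in> P" by (auto simp: P_def)
    moreover have "p i < z (Suc k)" using k by (simp add: z_def)
    ultimately have "p (Suc i) \<le> z (Suc k)" using p(3)[OF that] by fastforce
    also have "\<dots> \<le> p i + h" using k by (simp add: z_def algebra_simps)
    finally show ?thesis using h by simp
  qed
  moreover have "p 0 = - L"
  proof -
    obtain i where "i \<le> Suc n" "p i = - L" using P(2) p(1) by auto
    then show ?thesis using mono[of 0 i] in_P[of 0] P(4) by force
  qed
  moreover have "p (Suc n) = L"
  proof -
    obtain i where "i \<le> Suc n" "p i = L" using P(3) p(1) by auto
    then show ?thesis using mono[of i "Suc n"] in_P[of "Suc n"] P(4) by force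
  qed
  moreover have "X \<inter> {p i<..<p (Suc i)} = {}" if "i \<le> n" for i
    using p(3)[OF that] by (auto simp: P_def)
  ultimately show ?thesis using p(2) in_P P(4) by (intro exI[of _ n] exI[of _ p]) blast
qed

text \<open>Each hat is a difference \<open>u i - u (i - 1)\<close> of cut-offs, where \<open>u i\<close> is 1 to the left of \<open>p i\<close>
and 0 to the right of \<open>p (i + 1)\<close>, so the sum telescopes.\<close>

lemma sum_hats:
  fixes p :: "nat \<Rightarrow> real"
  assumes p: "\<And>i. i \<le> n \<Longrightarrow> p i < p (Suc i)"
  defines "S \<equiv> \<lambda>t. \<Sum>i=1..n. hat (p (i - 1)) (p i) (p (i + 1)) t"
  shows "S t \<le> 1" and "p 1 \<le> t \<Longrightarrow> t \<le> p n \<Longrightarrow> S t = 1"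
proof -
  define u where "u i = (max 0 (p (Suc i) - t) - max 0 (p i - t)) / (p (Suc i) - p i)" for i
  have "hat (p (i - 1)) (p i) (p (i + 1)) t = u i - u (i - 1)" if "i \<in> {1..n}" for i
    using that by (simp add: hat_def kink_def u_def)
  then have "S t = (\<Sum>i=1..n. u i - u (i - 1))" unfolding S_def by (intro sum.cong) auto
  then have S: "S t = u n - u 0" using sum_telescope''[of 0 n u] by simp
  have "u i \<le> 1" "u i \<ge> 0" if "i \<le> n" for i
  proof -
    have "max 0 (p (Suc i) - t) - max 0 (p i - t) \<le> p (Suc i) - p i"
      "0 \<le> max 0 (p (Suc i) - t) - max 0 (p i - t)"
      using p[OF that] by linarith+
    then show "u i \<le> 1" "u i \<ge> 0" using p[OF that] by (simp_all add: u_def)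
  qed
  from this(1)[of n] this(2)[of 0] show "S t \<le> 1" using S by simp
  assume "p 1 \<le> t" "t \<le> p n"
  then have "u 0 = 0" "u n = 1" using p[of 0] p[of n] by (simp_all add: u_def max_def)
  then show "S t = 1" using S by simp
qed

text \<open>A function vanishing at infinity is uniformly close to its piecewise linear interpolation on a grid that
is fine and long enough. The interpolation has the nonnegative weights \<open>hat\<close>, with sum \<open>S \<le> 1\<close>: the
error is a weighted mean of oscillations of \<open>g\<close> plus \<open>(1 - S) * g\<close>, and \<open>S = 1\<close> except where \<open>g\<close> is
small. Putting a finite set \<open>X\<close> into the grid keeps it out of the interior of every cell.\<close>

lemma hat_approximation:
  assumes g: "g \<in> C0" and X: "finite X" and e: "e > 0"
  shows "\<exists>n p. (\<forall>i\<le>n. p i < p (Suc i) \<and> X \<inter> {p i<..<p (Suc i)} = {}) \<and>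
     (\<forall>t. \<bar>g t - (\<Sum>i=1..n. g (p i) * hat (p (i - 1)) (p i) (p (i + 1)) t)\<bar> \<le> e)"
proof -
  have "\<forall>\<^sub>F t in at_top. \<bar>g t\<bar> < e" "\<forall>\<^sub>F t in at_bot. \<bar>g t\<bar> < e"
    using g e order_tendstoD(2)[OF tendsto_rabs_zero, of g _ e] by (auto simp: C0_def)
  then obtain u l where ul: "\<And>t. t \<ge> u \<Longrightarrow> \<bar>g t\<bar> < e" "\<And>t. t \<le> l \<Longrightarrow> \<bar>g t\<bar> < e"
    by (auto simp: eventually_at_top_linorder eventually_at_bot_linorder)
  obtain K where K: "\<And>a. a \<in> X \<Longrightarrow> \<bar>a\<bar> \<le> K"
    using finite_imp_bounded[OF X] by (auto simp: bounded_iff)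
  define L where "L = \<bar>K\<bar> + \<bar>u\<bar> + \<bar>l\<bar> + 1"
  have X_sub: "X \<subseteq> {- L..L}"
  proof
    fix a assume "a \<in> X"
    from K[OF this] show "a \<in> {- L..L}" by (auto simp: L_def)
  qed
  have L: "L > 0" by (simp add: L_def)
  \<comment> \<open>The margin 1 in \<open>L\<close> matters: the outermost cells, where the hats do not add up to 1, lie in the tails.\<close>
  have tail: "\<bar>g t\<bar> \<le> e" if "t \<le> - L + 1 \<or> L - 1 \<le> t" for t
    using ul[of t] that by (fastforce simp: L_def)
  have "uniformly_continuous_on {- L..L} g"
    using g by (intro compact_uniformly_continuous) (auto simp: C0_def intro: continuous_on_subset)
  then obtain d where d: "d > 0"
    "\<And>s t. s \<in> {- L..L} \<Longrightarrow> t \<in> {- L..L} \<Longrightarrow> \<bar>s - t\<bar> < d \<Longrightarrow> \<bar>g s - g t\<bar> < e"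
    using e unfolding uniformly_continuous_on_def dist_real_def by metis
  have min_pos: "min (d / 2) 1 > 0" using d(1) by simp
  obtain n p where grid: "\<forall>i\<le>n. p i < p (Suc i) \<and> X \<inter> {p i<..<p (Suc i)} = {} \<and>
        p (Suc i) - p i \<le> min (d / 2) 1"
    and ends: "p 0 = - L" "p (Suc n) = L" and in_L: "\<And>i. i \<le> Suc n \<Longrightarrow> p i \<in> {- L..L}"
    using fine_grid_exists[OF X X_sub L min_pos] by blast
  have p: "p i < p (Suc i)" "X \<inter> {p i<..<p (Suc i)} = {}" "p (Suc i) - p i \<le> min (d / 2) 1"
    if "i \<le> n" for i
    using grid that by blast+
  let ?h = "\<lambda>i. hat (p (i - 1)) (p i) (p (i + 1))"
  have "\<bar>g t - (\<Sum>i=1..n. g (p i) * ?h i t)\<bar> \<le> e" for t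
  proof -
    define S where "S = (\<Sum>i=1..n. ?h i t)"
    have nbrs: "p (i - 1) < p i" "p i < p (i + 1)" if "i \<in> {1..n}" for i
      using p(1)[of i] p(1)[of "i - 1"] that by auto
    have h_nn: "0 \<le> ?h i t" if "i \<in> {1..n}" for i
      using hat_bounds(1)[OF nbrs[OF that]] .
    have osc: "\<bar>(g t - g (p i)) * ?h i t\<bar> \<le> e * ?h i t" if i: "i \<in> {1..n}" for i
    proof (cases "t \<le> p (i - 1) \<or> p (i + 1) \<le> t")
      case True
      then show ?thesis using hat_zero[OF nbrs[OF i]] by simp
    next
      case False
      moreover have "i - 1 \<le> n" "Suc (i - 1) = i" using i by auto
      ultimately have "\<bar>t - p i\<bar> < d" "t \<in> {- L..L}"
        using nbrs[OF i] p(3)[of i] p(3)[of "i - 1"] in_L[of "i - 1"] in_L[of "i + 1"] i d(1) by auto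
      then have "\<bar>g t - g (p i)\<bar> \<le> e" using d(2)[of t "p i"] in_L[of i] i by auto
      then show ?thesis using h_nn[OF i] by (simp add: abs_mult mult_right_mono)
    qed
    have "\<bar>\<Sum>i=1..n. (g t - g (p i)) * ?h i t\<bar> \<le> (\<Sum>i=1..n. e * ?h i t)"
      by (rule order_trans[OF sum_abs sum_mono]) (rule osc)
    also have "\<dots> = e * S" by (simp add: S_def sum_distrib_left)
    finally have near: "\<bar>\<Sum>i=1..n. (g t - g (p i)) * ?h i t\<bar> \<le> e * S" .
    have S: "S \<le> 1" "p 1 \<le> t \<Longrightarrow> t \<le> p n \<Longrightarrow> S = 1"
      using sum_hats[of n p t] p(1) by (auto simp: S_def)
    have "\<bar>g t * (1 - S)\<bar> \<le> e * (1 - S)"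
    proof (cases "p 1 \<le> t \<and> t \<le> p n")
      case True then show ?thesis using S by simp
    next
      case False
      then have "\<bar>g t\<bar> \<le> e" using p(3)[of 0] p(3)[of n] ends by (intro tail) auto
      then show ?thesis using S(1) by (simp add: abs_mult mult_right_mono)
    qed
    moreover have "g t - (\<Sum>i=1..n. g (p i) * ?h i t) =
        g t * (1 - S) + (\<Sum>i=1..n. (g t - g (p i)) * ?h i t)"
      by (simp add: S_def left_diff_distrib sum_subtractf sum_distrib_left algebra_simps)
    ultimately have "\<bar>g t - (\<Sum>i=1..n. g (p i) * ?h i t)\<bar> \<le> e * (1 - S) + e * S"
      using near by linarith
    then show ?thesis by (simp add: algebra_simps)
  qed
  then show ?thesis using p(1,2) by (intro exI[of _ n] exI[of _ p]) blast
qed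

lemma hat_sum_C0:
  assumes "\<And>i. i \<le> n \<Longrightarrow> p i < p (Suc i)"
  shows "i \<in> {1..n} \<Longrightarrow> hat (p (i - 1)) (p i) (p (i + 1)) \<in> C0"
    and "(\<lambda>t. \<Sum>i=1..n. c i * hat (p (i - 1)) (p i) (p (i + 1)) t) \<in> C0"
proof -
  show *: "hat (p (i - 1)) (p i) (p (i + 1)) \<in> C0" if "i \<in> {1..n}" for i
    using assms[of "i - 1"] assms[of i] that by (intro hat_C0) auto
  show "(\<lambda>t. \<Sum>i=1..n. c i * hat (p (i - 1)) (p i) (p (i + 1)) t) \<in> C0"
    using C0_sum[of "{1..n}" "\<lambda>i. hat (p (i - 1)) (p i) (p (i + 1))" c] * by blast
qed

text \<open>By approximation, \<open>w g\<close> is a limit of sums of the terms \<open>g q * w (hat p q r)\<close>. Only hats whose two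
cells do not meet \<open>X\<close> occur, which later confines each hat to at most two data intervals.\<close>

lemma Radon_nonneg_if_nonneg_on_hats:
  assumes w: "w \<in> Radon_measures" and g: "g \<in> C0" and X: "finite X"
    and nn: "\<And>p q r. p < q \<Longrightarrow> q < r \<Longrightarrow> X \<inter> {p<..<q} = {} \<Longrightarrow> X \<inter> {q<..<r} = {} \<Longrightarrow>
       g q * w (hat p q r) \<ge> 0"
  shows "w g \<ge> 0"
proof -
  obtain B where B: "B \<ge> 0" "\<And>g K. g \<in> C0 \<Longrightarrow> (\<forall>t. \<bar>g t\<bar> \<le> K) \<Longrightarrow> \<bar>w g\<bar> \<le> B * K"
    using Radon_bounded[OF w] by blast
  have "\<bar>min 0 (w g)\<bar> \<le> B * e" if e: "e > 0" for e
  proof -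
    obtain n p where p: "\<And>i. i \<le> n \<Longrightarrow> p i < p (Suc i)" "\<And>i. i \<le> n \<Longrightarrow> X \<inter> {p i<..<p (Suc i)} = {}"
      "\<forall>t. \<bar>g t - (\<Sum>i=1..n. g (p i) * hat (p (i - 1)) (p i) (p (i + 1)) t)\<bar> \<le> e"
      using hat_approximation[OF g X e] by blast
    let ?a = "\<lambda>t. \<Sum>i=1..n. g (p i) * hat (p (i - 1)) (p i) (p (i + 1)) t"
    have "w ?a = (\<Sum>i=1..n. g (p i) * w (hat (p (i - 1)) (p i) (p (i + 1))))"
      using hat_sum_C0(1)[of n p, OF p(1)] by (intro Radon_sum[OF w]) auto
    moreover have "\<dots> \<ge> 0"
    proof (rule sum_nonneg)
      fix i assume i: "i \<in> {1..n}"
      then have "i - 1 \<le> n" "i \<le> n" "Suc (i - 1) = i" by auto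
      then show "0 \<le> g (p i) * w (hat (p (i - 1)) (p i) (p (i + 1)))"
        using p(1)[of "i - 1"] p(1)[of i] p(2)[of "i - 1"] p(2)[of i] by (intro nn) simp_all
    qed
    moreover have "w (\<lambda>t. g t - ?a t) = w g - w ?a"
      by (rule Radon_diff[OF w g hat_sum_C0(2)[of n p, OF p(1)]])
    moreover have "\<bar>w (\<lambda>t. g t - ?a t)\<bar> \<le> B * e"
      by (rule B(2)[OF C0_diff[OF g hat_sum_C0(2)[of n p, OF p(1)]] p(3)])
    ultimately show ?thesis using B(1) e by (auto simp: min_def)
  qed
  then have "min 0 (w g) = 0" by (rule eq_zero_if_le_multiples)
  then show ?thesis by simp
qed

section \<open>Uniqueness of the second derivative and its norm\<close>

text \<open>On hats both measures are determined by \<open>f\<close>, and hats span a dense subspace.\<close>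

lemma represents_D2_unique:
  assumes f: "continuous_on UNIV f" and rep: "represents_D2 v f" "represents_D2 w f"
  shows "v = w"
proof (rule extensionalityI)
  have R: "v \<in> Radon_measures" "w \<in> Radon_measures" using rep by (auto simp: represents_D2_def)
  then show "v \<in> extensional C0" "w \<in> extensional C0" by (auto simp: Radon_measures_def)
  fix g :: "real \<Rightarrow> real" assume g: "g \<in> C0"
  obtain B where B: "B \<ge> 0" "\<And>g K. g \<in> C0 \<Longrightarrow> (\<forall>t. \<bar>g t\<bar> \<le> K) \<Longrightarrow> \<bar>v g\<bar> \<le> B * K"
    using Radon_bounded[OF R(1)] by blast
  obtain C where C: "C \<ge> 0" "\<And>g K. g \<in> C0 \<Longrightarrow> (\<forall>t. \<bar>g t\<bar> \<le> K) \<Longrightarrow> \<bar>w g\<bar> \<le> C * K"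
    using Radon_bounded[OF R(2)] by blast
  have "\<bar>v g - w g\<bar> \<le> (B + C) * e" if e: "e > 0" for e
  proof -
    obtain n p where p: "\<And>i. i \<le> n \<Longrightarrow> p i < p (Suc i)"
      "\<forall>t. \<bar>g t - (\<Sum>i=1..n. g (p i) * hat (p (i - 1)) (p i) (p (i + 1)) t)\<bar> \<le> e"
      using hat_approximation[OF g _ e, of "{}"] by auto
    let ?a = "\<lambda>t. \<Sum>i=1..n. g (p i) * hat (p (i - 1)) (p i) (p (i + 1)) t"
    have a: "?a \<in> C0" by (rule hat_sum_C0(2)[of n p, OF p(1)])
    have "v (hat (p (i - 1)) (p i) (p (i + 1))) = w (hat (p (i - 1)) (p i) (p (i + 1)))"
      if "i \<in> {1..n}" for i
    proof -
      have "p (i - 1) < p i" "p i < p (i + 1)" using p(1)[of "i - 1"] p(1)[of i] that by auto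
      then show ?thesis using rep f by (simp add: D2_hat)
    qed
    moreover have "v ?a = (\<Sum>i=1..n. g (p i) * v (hat (p (i - 1)) (p i) (p (i + 1))))"
      "w ?a = (\<Sum>i=1..n. g (p i) * w (hat (p (i - 1)) (p i) (p (i + 1))))"
      using hat_sum_C0(1)[of n p, OF p(1)] by (intro Radon_sum R; simp)+
    ultimately have "v ?a = w ?a" by simp
    moreover have "\<bar>v g - v ?a\<bar> \<le> B * e" "\<bar>w g - w ?a\<bar> \<le> C * e"
      using B(2)[OF C0_diff[OF g a] p(2)] C(2)[OF C0_diff[OF g a] p(2)]
        Radon_diff[OF R(1) g a] Radon_diff[OF R(2) g a] by simp_all
    ultimately show ?thesis by (simp add: algebra_simps)
  qed
  then have "v g - w g = 0" by (rule eq_zero_if_le_multiples)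
  then show "v g = w g" by simp
qed

lemma D2_eqI: "continuous_on UNIV f \<Longrightarrow> represents_D2 w f \<Longrightarrow> D2 f = w"
  unfolding D2_def using represents_D2_unique by blast

lemma represents_D2_D2: "f \<in> BV2 \<Longrightarrow> represents_D2 (D2 f) f"
  using D2_eqI by (auto simp: BV2_def)

lemma le_M_norm:
  assumes w: "w \<in> Radon_measures" and g: "g \<in> C0" "\<And>t. \<bar>g t\<bar> \<le> 1"
  shows "w g \<le> M_norm w"
  unfolding M_norm_def
proof (rule cSup_upper)
  show "w g \<in> {w g | g. g \<in> C0 \<and> sup_norm g \<le> 1}" using g sup_norm_le by blast
  obtain B where B: "\<And>g K. g \<in> C0 \<Longrightarrow> (\<forall>t. \<bar>g t\<bar> \<le> K) \<Longrightarrow> \<bar>w g\<bar> \<le> B * K"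
    using Radon_bounded[OF w] by blast
  have "w h \<le> B" if "h \<in> C0" "sup_norm h \<le> 1" for h
  proof -
    have "\<forall>t. \<bar>h t\<bar> \<le> 1" using abs_le_sup_norm[OF that(1)] that(2) order_trans by blast
    from B[OF that(1) this] show ?thesis by simp
  qed
  then show "bdd_above {w g | g. g \<in> C0 \<and> sup_norm g \<le> 1}" by (auto simp: bdd_above_def)
qed

lemma M_norm_le:
  assumes "\<And>g. g \<in> C0 \<Longrightarrow> (\<And>t. \<bar>g t\<bar> \<le> 1) \<Longrightarrow> w g \<le> K"
  shows "M_norm w \<le> K"
  unfolding M_norm_def
proof (rule cSup_least)
  have "sup_norm (\<lambda>t. 0) \<le> 1" by (rule sup_norm_le) simp
  then show "{w g | g. g \<in> C0 \<and> sup_norm g \<le> 1} \<noteq> {}" using C0_zero by blast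
next
  fix a assume "a \<in> {w g | g. g \<in> C0 \<and> sup_norm g \<le> 1}"
  then obtain g where "a = w g" "g \<in> C0" "sup_norm g \<le> 1" by blast
  then show "a \<le> K" using assms[of g] abs_le_sup_norm[of g] order_trans by blast
qed

section \<open>Dual certificates\<close>

text \<open>If \<open>\<eta>\<close> attains the norm of \<open>w\<close>, perturbing it by a multiple of a hat cannot increase \<open>w\<close> as long as the
perturbed function stays between -1 and 1. With \<open>\<sigma> = 1\<close> there is room to subtract a hat, so \<open>w\<close> is
nonnegative on it; with \<open>\<sigma> = - 1\<close> there is room to add one. The constant \<open>s\<close> is the size of the
perturbation.\<close>

lemma kink_nonneg_of_dual_certificate:
  assumes rep: "represents_D2 w f" and f: "continuous_on UNIV f"
    and \<eta>: "\<eta> \<in> C0" "\<And>t. \<bar>\<eta> t\<bar> \<le> 1" and opt: "M_norm w \<le> w \<eta>"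
    and pqr: "p < q" "q < r" and \<sigma>: "\<bar>\<sigma>\<bar> = 1"
    and s: "s > 0" and room: "\<And>t. s * hat p q r t \<le> 1 + \<sigma> * \<eta> t"
  shows "\<sigma> * kink f p q r \<ge> 0"
proof -
  have w: "w \<in> Radon_measures" using rep by (simp add: represents_D2_def)
  have \<sigma>\<sigma>: "\<sigma> * \<sigma> = 1" using \<sigma> by (metis abs_mult_self_eq mult_1)
  have bound: "\<bar>\<sigma> * \<eta> t\<bar> \<le> 1" for t using \<eta>(2)[of t] \<sigma> by (simp add: abs_mult)
  \<comment> \<open>A competitor for \<open>\<eta>\<close> in the supremum that defines the norm.\<close>
  define g where "g t = \<eta> t - (\<sigma> * s) * hat p q r t" for t
  have g: "g \<in> C0" unfolding g_def[abs_def] by (intro C0_diff \<eta> C0_cmult hat_C0 pqr)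
  have "\<bar>g t\<bar> \<le> 1" for t
  proof -
    have "\<sigma> * g t = \<sigma> * \<eta> t - s * hat p q r t"
      using \<sigma>\<sigma> by (simp add: g_def algebra_simps flip: mult.assoc)
    moreover note room[of t]
    moreover have "0 \<le> s * hat p q r t" using s hat_bounds[OF pqr] by simp
    ultimately have "\<bar>\<sigma> * g t\<bar> \<le> 1" using bound[of t] by linarith
    then show ?thesis using \<sigma> by (simp add: abs_mult)
  qed
  then have "w g \<le> w \<eta>" using le_M_norm[OF w g] opt by fastforce
  moreover have "w g = w \<eta> - (\<sigma> * s) * kink f p q r"
    unfolding g_def[abs_def]
    using Radon_diff[OF w \<eta>(1) C0_cmult[OF hat_C0[OF pqr]]] Radon_cmult[OF w hat_C0[OF pqr]]
      D2_hat[OF rep f pqr] by simp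
  ultimately have "0 \<le> s * (\<sigma> * kink f p q r)" by (simp add: mult_ac)
  then show ?thesis using s by (simp add: zero_le_mult_iff)
qed

section \<open>The second derivative of a piecewise linear function\<close>

lemma integral_pairing_bound:
  assumes f: "continuous_on UNIV f" "\<And>t. \<bar>f t\<bar> \<le> C * (1 + t\<^sup>2)"
    and \<psi>: "continuous_on UNIV \<psi>" "\<And>k. bounded (range (\<lambda>t. t ^ k * \<psi> t))"
  defines "N \<equiv> Schwartz_seminorm 0 0 \<psi> + 2 * Schwartz_seminorm 2 0 \<psi> + Schwartz_seminorm 4 0 \<psi>"
  shows "integrable lborel (\<lambda>t. f t * \<psi> t)"
    and "\<bar>LINT t|lborel. f t * \<psi> t\<bar> \<le> C * N * (LINT t|lborel. inverse (1 + t\<^sup>2))"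
proof -
  have C: "C \<ge> 0" using f(2)[of 0] by auto
  have sn: "\<bar>t ^ k * \<psi> t\<bar> \<le> Schwartz_seminorm k 0 \<psi>" for t k
    using \<psi>(2)[of k] unfolding Schwartz_seminorm_def funpow_0 id_apply
    by (intro cSUP_upper) (auto simp: bounded_iff bdd_above_def)
  have pos: "1 + t\<^sup>2 > 0" for t :: real by (simp add: add_pos_nonneg)
  have bound: "\<bar>f t * \<psi> t\<bar> \<le> C * N * inverse (1 + t\<^sup>2)" for t
  proof -
    \<comment> \<open>One factor \<open>1 + t\<^sup>2\<close> absorbs the growth of \<open>f\<close>, the other makes the bound integrable.\<close>
    have "(1 + t\<^sup>2) * ((1 + t\<^sup>2) * \<bar>\<psi> t\<bar>) = \<bar>t ^ 0 * \<psi> t\<bar> + 2 * \<bar>t ^ 2 * \<psi> t\<bar> + \<bar>t ^ 4 * \<psi> t\<bar>"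
      by (simp add: abs_mult power_even_abs algebra_simps flip: power_add)
    also have "\<dots> \<le> N" unfolding N_def using sn[of t 0] sn[of t 2] sn[of t 4] by linarith
    finally have "(1 + t\<^sup>2) * \<bar>\<psi> t\<bar> \<le> N * inverse (1 + t\<^sup>2)"
      using pos[of t] by (simp add: field_simps)
    then have "C * ((1 + t\<^sup>2) * \<bar>\<psi> t\<bar>) \<le> C * (N * inverse (1 + t\<^sup>2))"
      using C by (rule mult_left_mono)
    moreover have "\<bar>f t * \<psi> t\<bar> \<le> C * (1 + t\<^sup>2) * \<bar>\<psi> t\<bar>"
      using f(2)[of t] by (simp add: abs_mult mult_right_mono)
    ultimately show ?thesis by (simp add: mult.assoc)
  qed
  have "integrable lborel (\<lambda>t::real. inverse (1 + t\<^sup>2))"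
    using integrable_inverse_1_plus_square by (simp add: set_integrable_def)
  then have int: "integrable lborel (\<lambda>t. C * N * inverse (1 + t\<^sup>2))" by simp
  have meas: "(\<lambda>t. f t * \<psi> t) \<in> borel_measurable lborel"
    using continuous_on_mult[OF f(1) \<psi>(1)] borel_measurable_continuous_onI by simp
  show I: "integrable lborel (\<lambda>t. f t * \<psi> t)"
  proof (rule Bochner_Integration.integrable_bound[OF int meas], rule AE_I2)
    fix t
    show "norm (f t * \<psi> t) \<le> norm (C * N * inverse (1 + t\<^sup>2))"
      unfolding real_norm_def using bound[of t] by linarith
  qed
  show "\<bar>LINT t|lborel. f t * \<psi> t\<bar> \<le> C * N * (LINT t|lborel. inverse (1 + t\<^sup>2))"
    using integral_abs_bound_integral[OF I int bound] by simp
qed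

text \<open>The pairing with \<open>f\<close> is bounded by a combination of three Schwartz seminorms.\<close>

lemma distr_of_tempered:
  assumes f: "continuous_on UNIV f" "\<And>t. \<bar>f t\<bar> \<le> C * (1 + t\<^sup>2)"
  shows "\<phi> \<in> Schwartz \<Longrightarrow> integrable lborel (\<lambda>t. f t * \<phi> t)"
    and "distr_of f \<in> tempered_distributions"
proof -
  have cont: "continuous_on UNIV \<phi>" and bdd: "bounded (range (\<lambda>t. t ^ k * \<phi> t))"
    if "\<phi> \<in> Schwartz" for \<phi> :: "real \<Rightarrow> real" and k
    using Schwartz_continuous[OF that, of UNIV 0] Schwartz_bounds[OF that, of k 0]
    by (auto simp: bounded_iff)
  show int: "integrable lborel (\<lambda>t. f t * \<phi> t)" if "\<phi> \<in> Schwartz" for \<phi>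
    using integral_pairing_bound(1)[OF f cont[OF that] bdd[OF that]] .
  have "(\<lambda>i. distr_of f (\<phi>s i)) \<longlonglongrightarrow> distr_of f \<phi>"
    if \<phi>: "\<phi> \<in> Schwartz" and \<phi>s: "\<And>i. \<phi>s i \<in> Schwartz"
      and lim: "\<And>k n. (\<lambda>i. Schwartz_seminorm k n (\<lambda>x. \<phi>s i x - \<phi> x)) \<longlonglongrightarrow> 0" for \<phi> \<phi>s
  proof -
    let ?d = "\<lambda>i x. \<phi>s i x - \<phi> x"
    let ?N = "\<lambda>i. Schwartz_seminorm 0 0 (?d i) + 2 * Schwartz_seminorm 2 0 (?d i)
        + Schwartz_seminorm 4 0 (?d i)"
    let ?J = "LINT t|lborel. inverse (1 + t\<^sup>2 :: real)"
    have close: "norm (distr_of f (\<phi>s i) - distr_of f \<phi>) \<le> C * ?N i * ?J" for i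
    proof -
      have "continuous_on UNIV (?d i)" by (intro continuous_intros cont \<phi> \<phi>s)
      moreover have "bounded (range (\<lambda>t. t ^ k * ?d i t))" for k
        using bounded_minus_comp[OF bdd[OF \<phi>s[of i], of k] bdd[OF \<phi>, of k]]
        by (simp add: right_diff_distrib)
      ultimately have "\<bar>LINT t|lborel. f t * ?d i t\<bar> \<le> C * ?N i * ?J"
        by (rule integral_pairing_bound(2)[OF f])
      moreover have "(LINT t|lborel. f t * ?d i t) = distr_of f (\<phi>s i) - distr_of f \<phi>"
        using int[OF \<phi>] int[OF \<phi>s[of i]] by (simp add: distr_of_def right_diff_distrib)
      ultimately show ?thesis by simp
    qed
    have "(\<lambda>i. C * ?N i * ?J) \<longlonglongrightarrow> C * (0 + 2 * 0 + 0) * ?J"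
      by (intro tendsto_intros lim)
    then have null: "(\<lambda>i. C * ?N i * ?J) \<longlonglongrightarrow> 0" by (simp only: mult_zero_right mult_zero_left add_0)
    have "(\<lambda>i. distr_of f (\<phi>s i) - distr_of f \<phi>) \<longlonglongrightarrow> 0"
      by (rule Lim_null_comparison[OF always_eventually null]) (rule allI, rule close)
    then show ?thesis by (rule Lim_null[THEN iffD2])
  qed
  moreover have "distr_of f (\<lambda>x. \<phi> x + \<psi> x) = distr_of f \<phi> + distr_of f \<psi>"
    if "\<phi> \<in> Schwartz" "\<psi> \<in> Schwartz" for \<phi> \<psi>
    using int[OF that(1)] int[OF that(2)] by (simp add: distr_of_def distrib_left)
  moreover have "distr_of f (\<lambda>x. c * \<phi> x) = c * distr_of f \<phi>" for c \<phi>
    by (simp add: distr_of_def mult.left_commute[of _ c])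
  ultimately show "distr_of f \<in> tempered_distributions"
    unfolding tempered_distributions_def by blast
qed

text \<open>Integration by parts on \<open>[z, \<infinity>)\<close>: \<open>(t - z) \<phi>' - \<phi>\<close> is an antiderivative that vanishes at infinity.\<close>

lemma integral_ramp_deriv2:
  assumes \<phi>: "\<phi> \<in> Schwartz" and int: "integrable lborel (\<lambda>t. max 0 (t - z) * (deriv ^^ 2) \<phi> t)"
  shows "(LINT t|lborel. max 0 (t - z) * (deriv ^^ 2) \<phi> t) = \<phi> z"
proof -
  let ?D = "\<lambda>n. (deriv ^^ n) \<phi>"
  define F where "F t = (t - z) * ?D 1 t - ?D 0 t" for t
  have eq: "indicator {z<..} t * ((t - z) * ?D 2 t) = max 0 (t - z) * ?D 2 t" for t
    by (auto simp: indicator_def)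
  have dF: "(F has_real_derivative (t - z) * ?D 2 t) (at t)" for t
    unfolding F_def using Schwartz_has_derivative[OF \<phi>, of 0 t] Schwartz_has_derivative[OF \<phi>, of 1 t]
    by (auto intro!: derivative_eq_intros simp: numeral_2_eq_2)
  have cont: "isCont (\<lambda>t. (t - z) * ?D 2 t) t" for t
    using continuous_on_mult[OF _ Schwartz_continuous[OF \<phi>, of UNIV 2], of "\<lambda>t. t - z"]
    by (auto simp: continuous_on_eq_continuous_at intro!: continuous_intros)
  have "(F \<longlongrightarrow> F z) (at_right z)"
    using DERIV_isCont[OF dF] by (auto simp: isCont_def intro: tendsto_within_subset)
  moreover have "(F \<longlongrightarrow> 0) at_top"
  proof -
    have "((\<lambda>t. t ^ 1 * ?D 1 t - z * (t ^ 0 * ?D 1 t) - t ^ 0 * ?D 0 t) \<longlongrightarrow> 0 - z * 0 - 0) at_top"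
      by (intro tendsto_intros Schwartz_tendsto_0[OF \<phi> at_top_le_at_infinity])
    then show ?thesis by (simp add: F_def[abs_def] left_diff_distrib)
  qed
  ultimately have "(LBINT t=ereal z..\<infinity>. (t - z) * ?D 2 t) = 0 - F z"
    using int dF cont
    by (intro interval_integral_FTC_integrable[where F = F])
       (auto simp: set_integrable_def eq ereal_tendsto_simps has_real_derivative_iff_has_vector_derivative[symmetric])
  then show ?thesis
    by (simp add: interval_lebesgue_integral_def set_lebesgue_integral_def eq F_def)
qed

lemma integral_affine_deriv2:
  assumes \<phi>: "\<phi> \<in> Schwartz" and int: "integrable lborel (\<lambda>t. (a * t + b) * (deriv ^^ 2) \<phi> t)"
  shows "(LINT t|lborel. (a * t + b) * (deriv ^^ 2) \<phi> t) = 0"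
proof -
  let ?D = "\<lambda>n. (deriv ^^ n) \<phi>"
  define F where "F t = (a * t + b) * ?D 1 t - a * ?D 0 t" for t
  have dF: "(F has_real_derivative (a * t + b) * ?D 2 t) (at t)" for t
    unfolding F_def using Schwartz_has_derivative[OF \<phi>, of 0 t] Schwartz_has_derivative[OF \<phi>, of 1 t]
    by (auto intro!: derivative_eq_intros simp: numeral_2_eq_2)
  have cont: "isCont (\<lambda>t. (a * t + b) * ?D 2 t) t" for t
    using continuous_on_mult[OF _ Schwartz_continuous[OF \<phi>, of UNIV 2], of "\<lambda>t. a * t + b"]
    by (auto simp: continuous_on_eq_continuous_at intro!: continuous_intros)
  have lim: "(F \<longlongrightarrow> 0) L" if "L \<le> at_infinity" for L
  proof -
    have "((\<lambda>t. a * (t ^ 1 * ?D 1 t) + b * (t ^ 0 * ?D 1 t) - a * (t ^ 0 * ?D 0 t)) \<longlongrightarrow>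
        a * 0 + b * 0 - a * 0) L"
      by (intro tendsto_intros Schwartz_tendsto_0[OF \<phi> that])
    then show ?thesis by (simp add: F_def[abs_def] distrib_right mult.assoc)
  qed
  have "(LBINT t=-\<infinity>..\<infinity>. (a * t + b) * ?D 2 t) = 0 - 0"
    using int dF cont lim[OF at_top_le_at_infinity] lim[OF at_bot_le_at_infinity]
    by (intro interval_integral_FTC_integrable[where F = F])
       (auto simp: set_integrable_def ereal_tendsto_simps has_real_derivative_iff_has_vector_derivative[symmetric])
  then show ?thesis
    by (simp add: interval_lebesgue_integral_def set_lebesgue_integral_def)
qed

lemma piecewise_linear_growth:
  fixes c z :: "'i \<Rightarrow> real"
  shows "\<exists>C. \<forall>t. \<bar>a * t + b + (\<Sum>m\<in>I. c m * max 0 (t - z m))\<bar> \<le> C * (1 + t\<^sup>2)"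
proof -
  have t: "\<bar>t\<bar> \<le> 1 + t\<^sup>2" for t :: real
    using zero_le_power2[of "\<bar>t\<bar> - 1"] by (simp add: power2_diff)
  have one: "1 \<le> 1 + t\<^sup>2" for t :: real by simp
  let ?C = "\<bar>a\<bar> + \<bar>b\<bar> + (\<Sum>m\<in>I. \<bar>c m\<bar> * (1 + \<bar>z m\<bar>))"
  have "\<bar>a * t + b + (\<Sum>m\<in>I. c m * max 0 (t - z m))\<bar> \<le> ?C * (1 + t\<^sup>2)" for t
  proof -
    have "\<bar>c m * max 0 (t - z m)\<bar> \<le> \<bar>c m\<bar> * (1 + \<bar>z m\<bar>) * (1 + t\<^sup>2)" for m
    proof -
      have "\<bar>z m\<bar> * 1 \<le> \<bar>z m\<bar> * (1 + t\<^sup>2)" using one by (intro mult_left_mono) auto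
      then have "max 0 (t - z m) \<le> (1 + \<bar>z m\<bar>) * (1 + t\<^sup>2)"
        using t[of t] by (simp add: distrib_right)
      then show ?thesis by (simp add: abs_mult mult_left_mono mult.assoc)
    qed
    then have "\<bar>\<Sum>m\<in>I. c m * max 0 (t - z m)\<bar> \<le> (\<Sum>m\<in>I. \<bar>c m\<bar> * (1 + \<bar>z m\<bar>) * (1 + t\<^sup>2))"
      by (intro order_trans[OF sum_abs sum_mono]) auto
    moreover have "\<bar>a * t\<bar> \<le> \<bar>a\<bar> * (1 + t\<^sup>2)" using t[of t] by (simp add: abs_mult mult_left_mono)
    moreover have "\<bar>b\<bar> * 1 \<le> \<bar>b\<bar> * (1 + t\<^sup>2)" using one by (intro mult_left_mono) auto
    ultimately show ?thesis by (simp add: distrib_right sum_distrib_right)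
  qed
  then show ?thesis by blast
qed

lemma continuous_piecewise_linear:
  "continuous_on UNIV (\<lambda>t::real. a * t + b + (\<Sum>m\<in>I. c m * max 0 (t - z m)))"
  by (intro continuous_intros)

text \<open>The second derivative is the sum of the point masses \<open>c m\<close> at \<open>z m\<close>, because \<open>max 0 (t - z)\<close> has
second derivative \<open>\<delta>\<^sub>z\<close> and affine functions have none.\<close>

lemma piecewise_linear_D2:
  fixes a b :: real and c z :: "'i \<Rightarrow> real"
  assumes I: "finite I"
  defines "f \<equiv> \<lambda>t. a * t + b + (\<Sum>m\<in>I. c m * max 0 (t - z m))"
  shows "f \<in> BV2" and "D2 f = restrict (\<lambda>g. \<Sum>m\<in>I. c m * g (z m)) C0"
proof -
  let ?w = "restrict (\<lambda>g. \<Sum>m\<in>I. c m * g (z m)) C0"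
  obtain C where C: "\<And>t. \<bar>f t\<bar> \<le> C * (1 + t\<^sup>2)"
    using piecewise_linear_growth[of a b c z I] by (auto simp: f_def)
  have f: "continuous_on UNIV f" unfolding f_def by (rule continuous_piecewise_linear)
  have "?w (\<lambda>x. g x + h x) = ?w g + ?w h" if "g \<in> C0" "h \<in> C0" for g h
    using that C0_add[OF that] by (simp add: distrib_left sum.distrib)
  moreover have "?w (\<lambda>x. k * g x) = k * ?w g" if "g \<in> C0" for g k
    using that C0_cmult[OF that, of k] by (simp add: sum_distrib_left mult.left_commute)
  moreover have "\<bar>?w g\<bar> \<le> (\<Sum>m\<in>I. \<bar>c m\<bar>) * sup_norm g" if "g \<in> C0" for g
  proof -
    have "\<bar>\<Sum>m\<in>I. c m * g (z m)\<bar> \<le> (\<Sum>m\<in>I. \<bar>c m\<bar> * sup_norm g)"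
      using abs_le_sup_norm[OF that]
      by (intro order_trans[OF sum_abs sum_mono]) (simp add: abs_mult mult_left_mono)
    then show ?thesis using that by (simp add: sum_distrib_right)
  qed
  ultimately have w: "?w \<in> Radon_measures"
    unfolding Radon_measures_def mem_Collect_eq using restrict_extensional by blast
  have "?w \<phi> = distr_deriv (distr_deriv (distr_of f)) \<phi>" if \<phi>: "\<phi> \<in> Schwartz" for \<phi>
  proof -
    have d2: "(deriv ^^ 2) \<phi> \<in> Schwartz"
      using Schwartz_deriv[OF Schwartz_deriv[OF \<phi>]] by (simp add: numeral_2_eq_2)
    have int1: "integrable lborel (\<lambda>t. (a * t + b) * (deriv ^^ 2) \<phi> t)"
      using distr_of_tempered(1)[OF continuous_piecewise_linear[where I = "{}"]]
        piecewise_linear_growth[of a b c z "{}"] d2 by force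
    have int2: "integrable lborel (\<lambda>t. max 0 (t - z m) * (deriv ^^ 2) \<phi> t)" for m
      using distr_of_tempered(1)[OF continuous_piecewise_linear[of 0 0 "\<lambda>_. 1" z "{m}"]]
        piecewise_linear_growth[of 0 0 "\<lambda>_. 1" z "{m}"] d2 by force
    have "distr_deriv (distr_deriv (distr_of f)) \<phi> = (LINT t|lborel. f t * (deriv ^^ 2) \<phi> t)"
      by (simp add: distr_deriv_def distr_of_def numeral_2_eq_2)
    also have "\<dots> = (LINT t|lborel. (a * t + b) * (deriv ^^ 2) \<phi> t +
        (\<Sum>m\<in>I. c m * (max 0 (t - z m) * (deriv ^^ 2) \<phi> t)))"
      by (intro Bochner_Integration.integral_cong refl)
         (simp add: f_def distrib_right sum_distrib_right mult.assoc)
    also have "\<dots> = (LINT t|lborel. (a * t + b) * (deriv ^^ 2) \<phi> t) +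
        (\<Sum>m\<in>I. c m * (LINT t|lborel. max 0 (t - z m) * (deriv ^^ 2) \<phi> t))"
      using int1 int2 by (simp add: Bochner_Integration.integral_add Bochner_Integration.integral_sum)
    also have "\<dots> = (\<Sum>m\<in>I. c m * \<phi> (z m))"
      using integral_affine_deriv2[OF \<phi> int1] integral_ramp_deriv2[OF \<phi> int2] by simp
    finally show ?thesis using \<phi> Schwartz_subset_C0 by auto
  qed
  then have rep: "represents_D2 ?w f" using w by (simp add: represents_D2_def)
  then show "D2 f = ?w" by (rule D2_eqI[OF f])
  show "f \<in> BV2" using f distr_of_tempered[OF f C] rep by (auto simp: BV2_def)
qed

section \<open>The canonical interpolant\<close>

locale interpolation_data =
  fixes M :: nat and x y :: "nat \<Rightarrow> real"
  assumes M: "M \<ge> 4" and x_mono: "strict_mono_on {1..M} x"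
begin

abbreviation "a \<equiv> a_cano M x y"
abbreviation "fc \<equiv> f_cano M x y"
abbreviation "\<eta> \<equiv> eta_cano M x y"

lemma x_less: "1 \<le> i \<Longrightarrow> i < j \<Longrightarrow> j \<le> M \<Longrightarrow> x i < x j"
  using strict_mono_onD[OF x_mono, of i j] by simp

lemma x_le: "1 \<le> i \<Longrightarrow> i \<le> j \<Longrightarrow> j \<le> M \<Longrightarrow> x i \<le> x j"
  using x_less[of i j] by (cases "i = j") auto

lemma x_neighbours:
  assumes "m \<in> {2..M - 1}"
  shows "x (m - 1) < x m" "x m < x (m + 1)"
  using assms M by (auto intro!: x_less)

lemma locate:
  assumes "x 1 \<le> t" "t < x M"
  shows "\<exists>m\<in>{1..M - 1}. x m \<le> t \<and> t < x (m + 1)"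
proof -
  define S where "S = {k \<in> {1..M}. x k \<le> t}"
  have S: "finite S" "1 \<in> S" using assms M by (auto simp: S_def)
  define m where "m = Max S"
  have "m \<in> S" using S unfolding m_def by (intro Max_in) auto
  then have m: "m \<in> {1..M}" "x m \<le> t" by (auto simp: S_def)
  then have mM: "m < M" using assms by (metis atLeastAtMost_iff le_neq_implies_less not_le)
  have "t < x (m + 1)"
  proof (rule ccontr)
    assume "\<not> t < x (m + 1)"
    then have "m + 1 \<in> S" using mM by (simp add: S_def)
    then show False using Max_ge[OF S(1), of "m + 1"] by (simp add: m_def)
  qed
  then show ?thesis using m mM by (intro bexI[of _ m]) auto
qed

definition chord :: "nat \<Rightarrow> real \<Rightarrow> real" where
  "chord m t = y m + slope x y m * (t - x m)"

lemma chord_next: "m \<in> {1..M - 1} \<Longrightarrow> chord m (x (m + 1)) = y (m + 1)"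
proof -
  assume "m \<in> {1..M - 1}"
  then have "x m < x (m + 1)" using M by (intro x_less) auto
  then show "chord m (x (m + 1)) = y (m + 1)" by (simp add: chord_def slope_def)
qed

text \<open>Consecutive chords meet at the node \<open>x m\<close>, and their slopes differ by \<open>a m\<close>.\<close>

lemma chord_step:
  assumes "m \<in> {2..M - 1}"
  shows "chord m t = chord (m - 1) t + a m * (t - x m)"
proof -
  have "m - 1 \<in> {1..M - 1}" "m - 1 + 1 = m" using assms by auto
  then have "chord (m - 1) (x m) = y m" using chord_next[of "m - 1"] by simp
  moreover have "chord (m - 1) t = chord (m - 1) (x m) + slope x y (m - 1) * (t - x m)"
    by (simp add: chord_def algebra_simps)
  ultimately have prev: "chord (m - 1) t = y m + slope x y (m - 1) * (t - x m)" by simp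
  have a: "a m = slope x y m - slope x y (m - 1)"
    using assms by (auto simp: a_cano_def)
  show ?thesis unfolding prev a by (simp add: chord_def[of m] left_diff_distrib)
qed

lemma chord_eq_sum:
  assumes "1 \<le> m" "m \<le> M - 1"
  shows "chord m t = a 1 * t + a M + (\<Sum>k=2..m. a k * (t - x k))"
  using assms
proof (induction m rule: dec_induct)
  case base
  show ?case using M by (simp add: chord_def a_cano_def algebra_simps)
next
  case (step m)
  then have "chord (Suc m) t = chord m t + a (Suc m) * (t - x (Suc m))"
    using chord_step[of "Suc m" t] by simp
  then show ?case using step by simp
qed

text \<open>To the left of \<open>x (m + 1)\<close> only the ramps of index at most \<open>m\<close> are active, and they add up to the chord
by telescoping. The first and the last chord extend to the unbounded intervals.\<close>

lemma f_cano_eq_chord: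
  assumes m: "m \<in> {1..M - 1}" and t: "m = 1 \<or> x m \<le> t" "m = M - 1 \<or> t \<le> x (m + 1)"
  shows "fc t = chord m t"
proof -
  have "(\<Sum>k=2..M - 1. a k * max 0 (t - x k)) = (\<Sum>k=2..m. a k * (t - x k))"
  proof (rule sum.mono_neutral_cong_right)
    show "\<forall>k\<in>{2..M - 1} - {2..m}. a k * max 0 (t - x k) = 0"
    proof
      fix k assume k: "k \<in> {2..M - 1} - {2..m}"
      then have "x (m + 1) \<le> x k" using m by (intro x_le) auto
      then show "a k * max 0 (t - x k) = 0" using t(2) k by auto
    qed
    fix k assume k: "k \<in> {2..m}"
    then have "x k \<le> x m" using m by (intro x_le) auto
    then show "a k * max 0 (t - x k) = a k * (t - x k)" using t(1) k by auto
  qed (use m in auto)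
  then show ?thesis using chord_eq_sum[of m t] m by (simp add: f_cano_def)
qed

lemma f_cano_interpolates: "m \<in> {1..M} \<Longrightarrow> fc (x m) = y m"
proof -
  assume m: "m \<in> {1..M}"
  show ?thesis
  proof (cases "m = M")
    case True
    then have "fc (x m) = chord (M - 1) (x M)"
      using x_le[of "M - 1" M] M by (intro trans[OF f_cano_eq_chord[of "M - 1"]]) auto
    then show ?thesis using chord_next[of "M - 1"] M True by simp
  next
    case False
    then have "fc (x m) = chord m (x m)"
      using m x_le[of m "m + 1"] by (intro f_cano_eq_chord) auto
    then show ?thesis by (simp add: chord_def)
  qed
qed

text \<open>The endpoints \<open>p\<close> and \<open>r\<close> need not be nodes: the kink of a function that is affine on both sides depends
on its two slopes only.\<close>

lemma kink_f_cano_at_node: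
  assumes m: "m \<in> {2..M - 1}" and p: "x (m - 1) \<le> p" "p < x m" and r: "x m < r" "r \<le> x (m + 1)"
  shows "kink fc p (x m) r = a m"
proof -
  have "fc p = chord (m - 1) p" "fc (x m) = chord (m - 1) (x m)" "fc (x m) = chord m (x m)" "fc r = chord m r"
    using m p r by (auto intro!: f_cano_eq_chord)
  then have "fc r - fc (x m) = slope x y m * (r - x m)"
    "fc (x m) - fc p = slope x y (m - 1) * (x m - p)"
    by (simp_all add: chord_def algebra_simps)
  then show ?thesis using m p r by (auto simp: kink_def a_cano_def)
qed

text \<open>For an interpolating function, the kink at three consecutive nodes depends on the data alone.\<close>

lemma kink_interpolant:
  assumes "interpolates M x y f" "m \<in> {2..M - 1}"
  shows "kink f (x (m - 1)) (x m) (x (m + 1)) = a m"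
proof -
  have "kink f (x (m - 1)) (x m) (x (m + 1)) = kink fc (x (m - 1)) (x m) (x (m + 1))"
  proof -
    have "m - 1 \<in> {1..M}" "m \<in> {1..M}" "m + 1 \<in> {1..M}" using assms(2) by auto
    then show ?thesis using assms(1) f_cano_interpolates
      by (intro kink_cong) (simp_all add: interpolates_def)
  qed
  also have "\<dots> = a m" using x_neighbours[OF assms(2)] assms(2) by (intro kink_f_cano_at_node) auto
  finally show ?thesis .
qed

section \<open>The canonical dual certificate\<close>

definition node_hat :: "nat \<Rightarrow> real \<Rightarrow> real" where
  "node_hat m = hat (x (m - 1)) (x m) (x (m + 1))"

lemma node_hat_at_node:
  assumes "m \<in> {2..M - 1}" "k \<in> {1..M}"
  shows "node_hat m (x k) = (if k = m then 1 else 0)"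
proof -
  have "k = m \<or> x k \<le> x (m - 1) \<or> x (m + 1) \<le> x k"
    using assms x_le[of k "m - 1"] x_le[of "m + 1" k] by fastforce
  then show ?thesis
    using x_neighbours[OF assms(1)] assms hat_zero[OF x_neighbours[OF assms(1)], of "x k"]
    by (auto simp: node_hat_def hat_eq)
qed

lemma ramp_combination_affine:
  assumes m: "m \<in> {1..M - 1}" and l: "0 \<le> l" "l \<le> 1"
  shows "(\<Sum>k=1..M. c k * max 0 (x k - (x m + l * (x (m + 1) - x m)))) =
    (1 - l) * (\<Sum>k=1..M. c k * max 0 (x k - x m)) + l * (\<Sum>k=1..M. c k * max 0 (x k - x (m + 1)))"
proof -
  have mm: "x m < x (m + 1)" using m by (intro x_less) auto
  let ?t = "x m + l * (x (m + 1) - x m)"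
  have "0 \<le> l * (x (m + 1) - x m)" "l * (x (m + 1) - x m) \<le> 1 * (x (m + 1) - x m)"
    using l mm by (auto intro: mult_right_mono)
  then have t: "x m \<le> ?t" "?t \<le> x (m + 1)" by auto
  have "max 0 (x k - ?t) = (1 - l) * max 0 (x k - x m) + l * max 0 (x k - x (m + 1))"
    if k: "k \<in> {1..M}" for k
  proof (cases "k \<le> m")
    case True
    then have "x k \<le> x m" using k m by (intro x_le) auto
    then show ?thesis using t mm by simp
  next
    case False
    then have "x (m + 1) \<le> x k" using k m by (intro x_le) auto
    then show ?thesis using t mm by (simp add: algebra_simps)
  qed
  then have "(\<Sum>k=1..M. c k * max 0 (x k - ?t)) =
      (\<Sum>k=1..M. c k * ((1 - l) * max 0 (x k - x m) + l * max 0 (x k - x (m + 1))))"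
    by (intro sum.cong) auto
  then show ?thesis
    by (simp add: distrib_left sum.distrib sum_distrib_left mult.left_commute)
qed

text \<open>Under the moment conditions such a combination vanishes outside \<open>[x 1, x M]\<close>, and between nodes it is affine;
so its values at the inner nodes determine it. This yields uniqueness of the canonical certificate.\<close>

lemma ramp_combination_zero:
  assumes mom: "(\<Sum>k=1..M. c k) = 0" "(\<Sum>k=1..M. c k * x k) = 0"
    and nodes: "\<And>m. m \<in> {2..M - 1} \<Longrightarrow> (\<Sum>k=1..M. c k * max 0 (x k - x m)) = 0"
  shows "(\<Sum>k=1..M. c k * max 0 (x k - t)) = 0"
proof -
  let ?h = "\<lambda>t. \<Sum>k=1..M. c k * max 0 (x k - t)"
  have left: "?h t = 0" if "t \<le> x 1" for t
  proof -
    have "c k * max 0 (x k - t) = c k * x k - t * c k" if "k \<in> {1..M}" for k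
      using x_le[of 1 k] that \<open>t \<le> x 1\<close> by (simp add: algebra_simps)
    then have "?h t = (\<Sum>k=1..M. c k * x k - t * c k)" by (intro sum.cong) auto
    also have "\<dots> = 0" using mom by (simp add: sum_subtractf flip: sum_distrib_left)
    finally show ?thesis .
  qed
  have right: "?h t = 0" if "x M \<le> t" for t
  proof (intro sum.neutral ballI)
    fix k assume "k \<in> {1..M}"
    then show "c k * max 0 (x k - t) = 0" using x_le[of k M] that by simp
  qed
  have node: "?h (x m) = 0" if "m \<in> {1..M}" for m
    using left[of "x 1"] right[of "x M"] nodes[of m] that by (cases "m = 1 \<or> m = M") auto
  consider "t \<le> x 1" | "x M \<le> t" | "x 1 \<le> t" "t < x M" by linarith
  then show ?thesis
  proof cases
    case 3
    then obtain m where m: "m \<in> {1..M - 1}" "t \<in> {x m..x (m + 1)}" "x m < x (m + 1)"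
      using locate[of t] by fastforce
    then obtain l where "0 \<le> l" "l \<le> 1" "t = x m + l * (x (m + 1) - x m)"
      using segment_coordinate by metis
    then show ?thesis using ramp_combination_affine[OF m(1), of l c] node[of m] node[of "m + 1"] m(1)
      by auto
  qed (use left right in auto)
qed

text \<open>The combination of node hats with weights \<open>sgn (a m)\<close> has the prescribed node values. Each hat is a
divided difference of ramps, and divided differences annihilate affine functions, which are the two
moment conditions; so the combination is admissible and uniqueness applies.\<close>

lemma eta_cano_eq_hats_and_ramps:
  shows "\<eta> = (\<lambda>t. \<Sum>m=2..M - 1. sgn (a m) * node_hat m t)"
    and "\<exists>c. \<eta> = (\<lambda>t. \<Sum>k=1..M. c k * max 0 (x k - t))"
proof -
  define h where "h t = (\<Sum>m=2..M - 1. sgn (a m) * node_hat m t)" for t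
  define DD where "DD m F = (F (m + 1) - F m) / (x (m + 1) - x m) - (F m - F (m - 1)) / (x m - x (m - 1))"
    for m and F :: "nat \<Rightarrow> real"
  \<comment> \<open>Coefficients of the divided difference of a sequence at the indices \<open>m - 1, m, m + 1\<close>.\<close>
  define w where "w m k = (if k = m + 1 then 1 / (x (m + 1) - x m) else 0)
      - (if k = m then 1 / (x (m + 1) - x m) + 1 / (x m - x (m - 1)) else 0)
      + (if k = m - 1 then 1 / (x m - x (m - 1)) else 0)" for m k
  define c where "c k = (\<Sum>m=2..M - 1. sgn (a m) * w m k)" for k
  have wF: "(\<Sum>k=1..M. w m k * F k) = DD m F" if "m \<in> {2..M - 1}" for m F
  proof -
    have "(\<Sum>k=1..M. w m k * F k) =
      (\<Sum>k=1..M. if k = m + 1 then 1 / (x (m + 1) - x m) * F k else 0)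
      - (\<Sum>k=1..M. if k = m then (1 / (x (m + 1) - x m) + 1 / (x m - x (m - 1))) * F k else 0)
      + (\<Sum>k=1..M. if k = m - 1 then 1 / (x m - x (m - 1)) * F k else 0)"
      unfolding sum_subtractf[symmetric] sum.distrib[symmetric]
      by (intro sum.cong refl)
         (simp only: w_def left_diff_distrib distrib_right if_distrib[of "\<lambda>u. u * F _"] mult_zero_left)
    also have "\<dots> = DD m F"
    proof -
      have "m + 1 \<in> {1..M}" "m \<in> {1..M}" "m - 1 \<in> {1..M}" using that by auto
      then show ?thesis
        by (simp only: sum.delta finite_atLeastAtMost if_True)
           (simp add: DD_def diff_divide_distrib distrib_right)
    qed
    finally show ?thesis .
  qed
  have cF: "(\<Sum>k=1..M. c k * F k) = (\<Sum>m=2..M - 1. sgn (a m) * DD m F)" for F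
  proof -
    have "(\<Sum>k=1..M. c k * F k) = (\<Sum>k=1..M. \<Sum>m=2..M - 1. sgn (a m) * (w m k * F k))"
      by (simp add: c_def sum_distrib_right mult.assoc)
    also have "\<dots> = (\<Sum>m=2..M - 1. sgn (a m) * (\<Sum>k=1..M. w m k * F k))"
      by (subst sum.swap) (simp add: sum_distrib_left)
    also have "\<dots> = (\<Sum>m=2..M - 1. sgn (a m) * DD m F)"
      using wF by (intro sum.cong) auto
    finally show ?thesis .
  qed
  have DDx: "DD m x = 0" if "m \<in> {2..M - 1}" for m
    using x_neighbours[OF that] by (simp add: DD_def)
  have h_ramps: "h = (\<lambda>t. \<Sum>k=1..M. c k * max 0 (x k - t))"
    unfolding cF by (simp add: h_def fun_eq_iff node_hat_def hat_def kink_def DD_def)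
  have c0: "(\<Sum>k=1..M. c k) = 0" using cF[of "\<lambda>_. 1"] by (simp add: DD_def)
  have c1: "(\<Sum>k=1..M. c k * x k) = 0" unfolding cF using DDx by (intro sum.neutral) auto
  have h_nodes: "h (x m) = sgn (a m)" if "m \<in> {2..M - 1}" for m
  proof -
    have "h (x m) = (\<Sum>k=2..M - 1. if m = k then sgn (a k) else 0)"
      unfolding h_def using node_hat_at_node that by (intro sum.cong refl) auto
    then show ?thesis using that by simp
  qed
  have "\<eta> = h"
    unfolding eta_cano_def
  proof (rule the_equality)
    show "\<exists>c. h = (\<lambda>t. \<Sum>m=1..M. c m * max 0 (x m - t)) \<and> sum c {1..M} = 0 \<and>
      (\<Sum>m=1..M. c m * x m) = 0 \<and> (\<forall>m\<in>{2..M - 1}. h (x m) = sgn (a m))"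
      using h_ramps c0 c1 h_nodes by blast
  next
    fix g
    assume "\<exists>c. g = (\<lambda>t. \<Sum>m=1..M. c m * max 0 (x m - t)) \<and> sum c {1..M} = 0 \<and>
      (\<Sum>m=1..M. c m * x m) = 0 \<and> (\<forall>m\<in>{2..M - 1}. g (x m) = sgn (a m))"
    then obtain b where b: "g = (\<lambda>t. \<Sum>m=1..M. b m * max 0 (x m - t))" "sum b {1..M} = 0"
      "(\<Sum>m=1..M. b m * x m) = 0" "\<And>m. m \<in> {2..M - 1} \<Longrightarrow> g (x m) = sgn (a m)" by blast
    have diff: "(\<Sum>k=1..M. (b k - c k) * max 0 (x k - t)) = g t - h t" for t
      unfolding b(1) h_ramps by (simp add: left_diff_distrib sum_subtractf)
    have "(\<Sum>k=1..M. (b k - c k) * max 0 (x k - t)) = 0" for t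
    proof (rule ramp_combination_zero)
      show "(\<Sum>k=1..M. b k - c k) = 0" "(\<Sum>k=1..M. (b k - c k) * x k) = 0"
        using b c0 c1 by (simp_all add: left_diff_distrib sum_subtractf)
      show "(\<Sum>k=1..M. (b k - c k) * max 0 (x k - x m)) = 0" if "m \<in> {2..M - 1}" for m
        using diff[of "x m"] b(4)[OF that] h_nodes[OF that] by simp
    qed
    then show "g = h" using diff by (simp add: fun_eq_iff)
  qed
  then show "\<eta> = (\<lambda>t. \<Sum>m=2..M - 1. sgn (a m) * node_hat m t)"
    "\<exists>c. \<eta> = (\<lambda>t. \<Sum>k=1..M. c k * max 0 (x k - t))"
    using h_ramps by (auto simp: h_def[abs_def])
qed

text \<open>The value of the certificate at \<open>x m\<close> for every index, with 0 at the two end nodes, where the certificate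
leaves the data.\<close>

definition node_sign :: "nat \<Rightarrow> real" where
  "node_sign m = (if m \<in> {2..M - 1} then sgn (a m) else 0)"

lemma node_sign_cases: "node_sign m = - 1 \<or> node_sign m = 0 \<or> node_sign m = 1"
  by (auto simp: node_sign_def sgn_if)

lemma eta_cano_node: "k \<in> {1..M} \<Longrightarrow> \<eta> (x k) = node_sign k"
proof -
  assume k: "k \<in> {1..M}"
  have "\<eta> (x k) = (\<Sum>m=2..M - 1. if k = m then sgn (a m) else 0)"
    unfolding eta_cano_eq_hats_and_ramps(1) using node_hat_at_node k by (intro sum.cong refl) auto
  then show ?thesis by (simp add: node_sign_def)
qed

lemma eta_cano_segment:
  assumes "m \<in> {1..M - 1}" "0 \<le> l" "l \<le> 1"
  shows "\<eta> (x m + l * (x (m + 1) - x m)) = (1 - l) * node_sign m + l * node_sign (m + 1)"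
proof -
  obtain c where "\<eta> = (\<lambda>t. \<Sum>k=1..M. c k * max 0 (x k - t))"
    using eta_cano_eq_hats_and_ramps(2) by blast
  then show ?thesis
    using ramp_combination_affine[OF assms, of c] eta_cano_node[of m] eta_cano_node[of "m + 1"] assms(1)
    by auto
qed

lemma eta_cano_outside:
  assumes "t \<le> x 1 \<or> x M \<le> t"
  shows "\<eta> t = 0"
  unfolding eta_cano_eq_hats_and_ramps(1)
proof (intro sum.neutral ballI)
  fix m assume m: "m \<in> {2..M - 1}"
  then have "x 1 \<le> x (m - 1)" "x (m + 1) \<le> x M" by (auto intro!: x_le)
  then show "sgn (a m) * node_hat m t = 0"
    using assms hat_zero[OF x_neighbours[OF m], of t] by (auto simp: node_hat_def)
qed

lemma eta_cano_C0: "\<eta> \<in> C0"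
  unfolding eta_cano_eq_hats_and_ramps(1) using x_neighbours
  by (intro C0_sum) (auto simp: node_hat_def intro!: hat_C0)

lemma eta_cano_le_1: "\<bar>\<eta> t\<bar> \<le> 1"
proof (cases "t \<le> x 1 \<or> x M \<le> t")
  case True then show ?thesis by (simp add: eta_cano_outside)
next
  case False
  then obtain m where m: "m \<in> {1..M - 1}" "t \<in> {x m..x (m + 1)}" "x m < x (m + 1)"
    using locate[of t] by fastforce
  then obtain l where l: "0 \<le> l" "l \<le> 1" "t = x m + l * (x (m + 1) - x m)"
    using segment_coordinate by metis
  have "\<bar>(1 - l) * node_sign m\<bar> \<le> (1 - l) * 1" "\<bar>l * node_sign (m + 1)\<bar> \<le> l * 1"
    using l node_sign_cases[of m] node_sign_cases[of "m + 1"] by (auto simp: abs_mult)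
  then show ?thesis using eta_cano_segment[OF m(1) l(1,2)] l(3) by simp
qed

text \<open>The certificate is a combination of node hats, so its pairing with \<open>f''\<close> sees \<open>f\<close> only at the nodes. The
value is therefore the same for all interpolating functions.\<close>

lemma D2_eta_cano:
  assumes "represents_D2 w f" "continuous_on UNIV f" "interpolates M x y f"
  shows "w \<eta> = (\<Sum>m=2..M - 1. \<bar>a m\<bar>)"
proof -
  have w: "w \<in> Radon_measures" using assms(1) by (simp add: represents_D2_def)
  have "w \<eta> = (\<Sum>m=2..M - 1. sgn (a m) * w (node_hat m))"
    unfolding eta_cano_eq_hats_and_ramps(1) using x_neighbours
    by (intro Radon_sum[OF w]) (auto simp: node_hat_def intro!: hat_C0)
  also have "\<dots> = (\<Sum>m=2..M - 1. \<bar>a m\<bar>)"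
  proof (intro sum.cong refl)
    fix m assume m: "m \<in> {2..M - 1}"
    then have "w (node_hat m) = a m"
      using D2_hat[OF assms(1,2) x_neighbours[OF m]] kink_interpolant[OF assms(3) m]
      by (simp add: node_hat_def)
    then show "sgn (a m) * w (node_hat m) = \<bar>a m\<bar>" by (simp add: abs_sgn mult.commute)
  qed
  finally show ?thesis .
qed

section \<open>Strong duality\<close>

text \<open>The second derivative of the canonical interpolant is the sum of the masses \<open>a m\<close> at the inner nodes.\<close>

lemma f_cano_BV2: "fc \<in> BV2"
  and M_norm_D2_f_cano: "M_norm (D2 fc) \<le> (\<Sum>m=2..M - 1. \<bar>a m\<bar>)"
proof -
  have fc: "fc = (\<lambda>t. a 1 * t + a M + (\<Sum>m=2..M - 1. a m * max 0 (t - x m)))"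
    by (simp add: f_cano_def fun_eq_iff)
  show "fc \<in> BV2" unfolding fc by (rule piecewise_linear_D2) simp
  have D2: "D2 fc = restrict (\<lambda>g. \<Sum>m=2..M - 1. a m * g (x m)) C0"
    unfolding fc by (rule piecewise_linear_D2) simp
  show "M_norm (D2 fc) \<le> (\<Sum>m=2..M - 1. \<bar>a m\<bar>)"
  proof (rule M_norm_le)
    fix g assume g: "g \<in> C0" "\<And>t. \<bar>g t\<bar> \<le> 1"
    have "a m * g (x m) \<le> \<bar>a m\<bar>" for m
      using abs_ge_self[of "a m * g (x m)"] mult_left_mono[OF g(2)[of "x m"], of "\<bar>a m\<bar>"]
      by (simp add: abs_mult)
    then show "D2 fc g \<le> (\<Sum>m=2..M - 1. \<bar>a m\<bar>)"
      using g(1) by (auto simp: D2 intro: sum_mono)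
  qed
qed

text \<open>The pairing with the certificate is a lower bound for the norm of every admissible function; the canonical
interpolant attains it, so the minimizers are exactly the functions for which the bound is sharp.\<close>

lemma gBPC_solution_iff_dual:
  assumes f: "f \<in> BV2"
  shows "gBPC_solution M x y f \<longleftrightarrow> interpolates M x y f \<and> M_norm (D2 f) \<le> D2 f \<eta>"
proof -
  have val: "D2 g \<eta> = (\<Sum>m=2..M - 1. \<bar>a m\<bar>)" if "g \<in> BV2" "interpolates M x y g" for g
    using D2_eta_cano[OF represents_D2_D2[OF that(1)] _ that(2)] that(1) by (simp add: BV2_def)
  have lower: "(\<Sum>m=2..M - 1. \<bar>a m\<bar>) \<le> M_norm (D2 g)" if "g \<in> BV2" "interpolates M x y g" for g
    using le_M_norm[OF _ eta_cano_C0 eta_cano_le_1, of "D2 g"] represents_D2_D2[OF that(1)] val[OF that]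
    by (simp add: represents_D2_def)
  have cano: "interpolates M x y fc" using f_cano_interpolates by (simp add: interpolates_def)
  have "gBPC_solution M x y f \<longleftrightarrow>
      interpolates M x y f \<and> M_norm (D2 f) \<le> (\<Sum>m=2..M - 1. \<bar>a m\<bar>)"
    unfolding gBPC_solution_def is_arg_min_def
    using f cano f_cano_BV2 M_norm_D2_f_cano lower by (meson not_le order_trans)
  then show ?thesis using val[OF f] by auto
qed

section \<open>Saturation of the certificate\<close>

text \<open>A plateau cannot involve an end node, where \<open>node_sign\<close> is 0.\<close>

lemma plateau_nodes:
  assumes "node_sign m = \<tau>" "node_sign (m + 1) = \<tau>" "\<bar>\<tau>\<bar> = 1"
  shows "m \<in> {2..M - 2}"
  using assms by (auto simp: node_sign_def split: if_splits)

lemma eta_cano_plateau: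
  assumes "node_sign m = \<tau>" "node_sign (m + 1) = \<tau>" "\<bar>\<tau>\<bar> = 1" "t \<in> {x m..x (m + 1)}"
  shows "\<eta> t = \<tau>"
proof -
  have m: "m \<in> {1..M - 1}" "x m < x (m + 1)"
    using plateau_nodes[OF assms(1-3)] M by (auto intro: x_less)
  then obtain l where "0 \<le> l" "l \<le> 1" "t = x m + l * (x (m + 1) - x m)"
    using segment_coordinate assms(4) by metis
  then show ?thesis using eta_cano_segment[OF m(1), of l] assms(1,2) by (simp add: left_diff_distrib)
qed

text \<open>A strict convex combination of two numbers from \<open>{-1, 0, 1}\<close> has modulus 1 only if they agree and are
nonzero.\<close>

lemma eta_cano_lt_1_off_plateau:
  assumes m: "m \<in> {1..M - 1}" and no: "\<not> (node_sign m = node_sign (m + 1) \<and> \<bar>node_sign m\<bar> = 1)"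
    and t: "x m < t" "t < x (m + 1)"
  shows "\<bar>\<eta> t\<bar> < 1"
proof -
  have "x m < x (m + 1)" "t \<in> {x m..x (m + 1)}" using t by auto
  then obtain l where l: "0 \<le> l" "l \<le> 1" "t = x m + l * (x (m + 1) - x m)" "0 < l" "l < 1"
    using segment_coordinate t by metis
  have "\<bar>(1 - l) * node_sign m + l * node_sign (m + 1)\<bar> < 1"
    using node_sign_cases[of m] node_sign_cases[of "m + 1"] no l(4,5) by auto
  then show ?thesis using eta_cano_segment[OF m l(1,2)] l(3) by simp
qed

text \<open>Around a plateau of height \<open>\<tau>\<close> the function \<open>\<tau> * \<eta>\<close> is a trapezoid over three consecutive intervals. The
strict lower bound inside leaves room for perturbation by hats with any three nodes there.\<close>

lemma plateau_concave:
  assumes m: "node_sign m = \<tau>" "node_sign (m + 1) = \<tau>" and \<tau>: "\<bar>\<tau>\<bar> = 1"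
  shows "concave_on {x (m - 1)..x (m + 2)} (\<lambda>t. \<tau> * \<eta> t)"
    and "x (m - 1) < q \<Longrightarrow> q < x (m + 2) \<Longrightarrow> \<tau> * \<eta> q > - 1"
proof -
  have mM: "m \<in> {2..M - 2}" by (rule plateau_nodes[OF m \<tau>])
  have \<tau>\<tau>: "\<tau> * \<tau> = 1" using \<tau> by (metis abs_mult_self_eq mult_1)
  have less: "x (m - 1) < x m" "x m < x (m + 1)" "x (m + 1) < x (m + 2)"
    using mM M by (auto intro!: x_less)
  \<comment> \<open>On the plateau interval and its two neighbours, \<open>\<tau> * \<eta>\<close> is the minimum of three affine functions
    with slopes \<open>u\<close>, 0 and \<open>- v\<close>.\<close>
  define u v where "u = (1 - \<tau> * node_sign (m - 1)) / (x m - x (m - 1))"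
    and "v = (1 - \<tau> * node_sign (m + 2)) / (x (m + 2) - x (m + 1))"
  have bound: "\<tau> * node_sign k \<le> 1" "\<tau> * node_sign k \<ge> - 1" for k
    using node_sign_cases[of k] \<tau> by auto
  have uv: "u \<ge> 0" "v \<ge> 0" using less bound by (simp_all add: u_def v_def)
  have left: "\<tau> * \<eta> t = 1 + u * (t - x m)" if t: "t \<in> {x (m - 1)..x m}" for t
  proof -
    obtain l where l: "0 \<le> l" "l \<le> 1" "t = x (m - 1) + l * (x m - x (m - 1))"
      using segment_coordinate[OF less(1) t] by metis
    have "m - 1 \<in> {1..M - 1}" "m - 1 + 1 = m" using mM by auto
    then have \<eta>t: "\<eta> t = (1 - l) * node_sign (m - 1) + l * \<tau>"
      using eta_cano_segment[of "m - 1" l] l m by simp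
    have t: "t - x m = (l - 1) * (x m - x (m - 1))" using l(3) by (simp add: algebra_simps)
    have u: "u * (x m - x (m - 1)) = 1 - \<tau> * node_sign (m - 1)"
      using less by (simp add: u_def)
    have "\<tau> * \<eta> t = 1 + (l - 1) * (1 - \<tau> * node_sign (m - 1))"
      unfolding \<eta>t using \<tau>\<tau> by (simp add: algebra_simps)
    also have "\<dots> = 1 + u * (t - x m)" by (simp only: t mult.left_commute[of u] u)
    finally show ?thesis .
  qed
  have right: "\<tau> * \<eta> t = 1 + v * (x (m + 1) - t)" if t: "t \<in> {x (m + 1)..x (m + 2)}" for t
  proof -
    obtain l where l: "0 \<le> l" "l \<le> 1" "t = x (m + 1) + l * (x (m + 2) - x (m + 1))"
      using segment_coordinate[OF less(3) t] by metis
    have "m + 1 \<in> {1..M - 1}" "m + 1 + 1 = m + 2" using mM M by auto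
    then have \<eta>t: "\<eta> t = (1 - l) * \<tau> + l * node_sign (m + 2)"
      using eta_cano_segment[of "m + 1" l] l m by simp
    have t: "x (m + 1) - t = - l * (x (m + 2) - x (m + 1))" using l(3) by (simp add: algebra_simps)
    have v: "v * (x (m + 2) - x (m + 1)) = 1 - \<tau> * node_sign (m + 2)"
      using less by (simp add: v_def)
    have "\<tau> * \<eta> t = 1 + - l * (1 - \<tau> * node_sign (m + 2))"
      unfolding \<eta>t using \<tau>\<tau> by (simp add: algebra_simps)
    also have "\<dots> = 1 + v * (x (m + 1) - t)" by (simp only: t mult.left_commute[of v] v)
    finally show ?thesis .
  qed
  have middle: "\<tau> * \<eta> t = 1" if "t \<in> {x m..x (m + 1)}" for t
    using eta_cano_plateau[OF m \<tau> that] \<tau>\<tau> by simp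
  let ?g = "\<lambda>t. min (1 + u * (t - x m)) (min 1 (1 + v * (x (m + 1) - t)))"
  have eq: "\<tau> * \<eta> t = ?g t" if t: "t \<in> {x (m - 1)..x (m + 2)}" for t
  proof -
    consider "t \<in> {x (m - 1)..x m}" | "t \<in> {x m..x (m + 1)}" | "t \<in> {x (m + 1)..x (m + 2)}"
      using t by (metis atLeastAtMost_iff linear)
    then show ?thesis
    proof cases
      case 1
      then have "u * (t - x m) \<le> 0" "v * (x (m + 1) - t) \<ge> 0"
        using uv less by (auto intro!: mult_nonneg_nonpos mult_nonneg_nonneg)
      then show ?thesis using left[OF 1] by simp
    next
      case 2
      then have "u * (t - x m) \<ge> 0" "v * (x (m + 1) - t) \<ge> 0" using uv by auto
      then show ?thesis using middle[OF 2] by simp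
    next
      case 3
      then have "u * (t - x m) \<ge> 0" "v * (x (m + 1) - t) \<le> 0"
        using uv less by (auto intro!: mult_nonneg_nonpos mult_nonneg_nonneg)
      then show ?thesis using right[OF 3] by simp
    qed
  qed
  have affine: "?g = (\<lambda>t. min ((1 - u * x m) + u * t) (min (1 + 0 * t) ((1 + v * x (m + 1)) + (- v) * t)))"
    by (simp add: fun_eq_iff algebra_simps)
  have "concave_on {x (m - 1)..x (m + 2)} ?g"
    unfolding affine by (intro concave_on_min concave_on_affine) auto
  then show "concave_on {x (m - 1)..x (m + 2)} (\<lambda>t. \<tau> * \<eta> t)"
    using eq by (rule concave_on_transfer)
  assume q: "x (m - 1) < q" "q < x (m + 2)"
  have strict: "c * d < 2" if "c \<ge> 0" "c * e \<le> 2" "d < e" for c d e :: real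
  proof (cases "c = 0")
    case False
    then have "c * d < c * e" using that by (intro mult_strict_left_mono) auto
    then show ?thesis using that(2) by linarith
  qed simp
  have "u * (x m - q) < 2"
    using less bound[of "m - 1"] uv q by (intro strict[of u "x m - x (m - 1)"]) (simp_all add: u_def)
  moreover have "v * (q - x (m + 1)) < 2"
    using less bound[of "m + 2"] uv q
    by (intro strict[of v "x (m + 2) - x (m + 1)"]) (simp_all add: v_def)
  ultimately have "?g q > - 1" by (simp add: algebra_simps)
  then show "\<tau> * \<eta> q > - 1" using eq[of q] q by simp
qed

lemma eq_chord_if_kink_zero:
  assumes "m \<in> {1..M - 1}" "interpolates M x y f" "x m < t" "t < x (m + 1)"
    "kink f (x m) t (x (m + 1)) = 0"
  shows "f t = chord m t"
proof -
  have nodes: "f (x m) = chord m (x m)" "f (x (m + 1)) = chord m (x (m + 1))"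
    using assms(1,2) chord_next[OF assms(1)] by (auto simp: interpolates_def chord_def)
  have "(f (x (m + 1)) - f t) / (x (m + 1) - t) = (f t - f (x m)) / (t - x m)"
    using assms(5) by (simp add: kink_def)
  then have "(f (x (m + 1)) - f t) * (t - x m) = (f t - f (x m)) * (x (m + 1) - t)"
    using assms(3,4) by (simp add: frac_eq_eq)
  then have "f t * (x (m + 1) - x m) = f (x (m + 1)) * (t - x m) + f (x m) * (x (m + 1) - t)"
    by (simp add: algebra_simps)
  also have "\<dots> = chord m t * (x (m + 1) - x m)"
    unfolding nodes by (simp add: chord_def algebra_simps)
  finally show ?thesis using assms(3,4) by simp
qed

section \<open>Minimizers and the conditions on intervals\<close>

context
  fixes f
  assumes f: "f \<in> BV2" and interp: "interpolates M x y f"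
begin

context
  assumes opt: "M_norm (D2 f) \<le> D2 f \<eta>"
begin

lemma minimizer_kink_nonneg:
  assumes "p < q" "q < r" "\<bar>\<tau>\<bar> = 1"
    "s > 0" "\<And>t. s * hat p q r t \<le> 1 + \<tau> * \<eta> t"
  shows "\<tau> * kink f p q r \<ge> 0"
  using kink_nonneg_of_dual_certificate[OF represents_D2_D2[OF f] _ eta_cano_C0 eta_cano_le_1 opt assms]
    f by (simp add: BV2_def)

text \<open>Where \<open>\<eta>\<close> leaves room on both sides, both signs of the perturbation are possible.\<close>

lemma minimizer_kink_zero:
  assumes "p < q" "q < r" "s > 0" "\<And>t. s * hat p q r t \<le> 1 - \<bar>\<eta> t\<bar>"
  shows "kink f p q r = 0"
proof -
  have "s * hat p q r t \<le> 1 + 1 * \<eta> t" "s * hat p q r t \<le> 1 + - 1 * \<eta> t" for t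
    using assms(4)[of t] by linarith+
  then have "1 * kink f p q r \<ge> 0" "- 1 * kink f p q r \<ge> 0"
    using minimizer_kink_nonneg[OF assms(1,2) _ assms(3)] by (metis abs_1 abs_minus_cancel)+
  then show ?thesis by simp
qed

text \<open>On the interval \<open>\<eta>\<close> is affine, hence both \<open>\<eta>\<close> and \<open>- \<eta>\<close> are concave, and multiples of the hat with nodes
\<open>x m\<close>, \<open>t\<close>, \<open>x (m + 1)\<close> fit below \<open>1 + \<eta>\<close> and \<open>1 - \<eta>\<close>: the kink at \<open>t\<close> vanishes.\<close>

lemma minimizer_eq_chord:
  assumes m: "m \<in> {1..M - 1}" and lt: "\<And>t. x m < t \<Longrightarrow> t < x (m + 1) \<Longrightarrow> \<bar>\<eta> t\<bar> < 1"
    and t: "x m \<le> t" "t \<le> x (m + 1)"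
  shows "f t = chord m t"
proof -
  have mem: "m \<in> {1..M}" "m + 1 \<in> {1..M}" using m M by auto
  consider "t = x m" | "t = x (m + 1)" | "x m < t" "t < x (m + 1)" using t by linarith
  then show ?thesis
  proof cases
    case 3
    let ?I = "{x m..x (m + 1)}"
    define v where "v = (node_sign (m + 1) - node_sign m) / (x (m + 1) - x m)"
    have aff: "\<eta> u = (node_sign m - v * x m) + v * u" if u: "u \<in> ?I" for u
    proof -
      obtain l where l: "0 \<le> l" "l \<le> 1" "u = x m + l * (x (m + 1) - x m)"
        using segment_coordinate[OF less_trans[OF 3] u] by metis
      have u: "u - x m = l * (x (m + 1) - x m)" using l(3) by simp
      have v: "v * (x (m + 1) - x m) = node_sign (m + 1) - node_sign m"
        using 3 by (simp add: v_def)
      have "\<eta> u = (1 - l) * node_sign m + l * node_sign (m + 1)"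
        using eta_cano_segment[OF m l(1,2)] l(3) by simp
      also have "\<dots> = node_sign m + l * (node_sign (m + 1) - node_sign m)"
        by (simp add: algebra_simps)
      also have "\<dots> = node_sign m + v * (u - x m)" by (simp only: u mult.left_commute[of v] v)
      finally show ?thesis by (simp add: algebra_simps)
    qed
    have room: "(1 + \<tau> * \<eta> t) * hat (x m) t (x (m + 1)) u \<le> 1 + \<tau> * \<eta> u"
      if \<tau>: "\<bar>\<tau>\<bar> = 1" for \<tau> u
    proof (rule concave_ge_hat[OF 3, where h = "\<lambda>u. \<tau> * \<eta> u"])
      have "concave_on ?I (\<lambda>u. \<tau> * (node_sign m - v * x m) + (\<tau> * v) * u)"
        by (rule concave_on_affine) simp
      then show "concave_on ?I (\<lambda>u. \<tau> * \<eta> u)"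
        by (rule concave_on_transfer) (simp add: aff distrib_left mult.assoc)
      fix u
      have "\<bar>\<tau> * \<eta> u\<bar> \<le> 1" using eta_cano_le_1[of u] \<tau> by (simp add: abs_mult)
      then show "\<tau> * \<eta> u \<ge> - 1" by linarith
    qed
    have "\<bar>\<eta> t\<bar> < 1" by (rule lt[OF 3])
    then have "(1 + 1 * \<eta> t) > 0" "(1 + - 1 * \<eta> t) > 0" by linarith+
    then have "1 * kink f (x m) t (x (m + 1)) \<ge> 0" "- 1 * kink f (x m) t (x (m + 1)) \<ge> 0"
      using minimizer_kink_nonneg[OF 3 _ _ room, of 1] minimizer_kink_nonneg[OF 3 _ _ room, of "- 1"]
      by simp_all
    then have "kink f (x m) t (x (m + 1)) = 0" by simp
    then show ?thesis by (rule eq_chord_if_kink_zero[OF m interp 3])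
  next
    case 1
    then show ?thesis using interp mem by (simp add: interpolates_def chord_def)
  next
    case 2
    then show ?thesis using interp mem chord_next[OF m] by (simp add: interpolates_def)
  qed
qed

text \<open>On the unbounded interval \<open>\<eta> = 0\<close>. For \<open>t < x 1\<close> the hat with nodes \<open>t\<close>, \<open>x 1\<close>, \<open>x 2\<close> is tested at full
height 1: on \<open>[x 1, x 2]\<close> it decreases from 1 to 0 while \<open>\<bar>\<eta>\<bar>\<close> increases linearly from 0 to at most 1.\<close>

lemma minimizer_left:
  assumes "t \<le> x 2"
  shows "f t = chord 1 t"
proof (cases "x 1 \<le> t")
  case True
  have "1 \<in> {1..M - 1}" using M by simp
  moreover have "\<not> (node_sign 1 = node_sign (1 + 1) \<and> \<bar>node_sign 1\<bar> = 1)" by (simp add: node_sign_def)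
  ultimately show ?thesis
    using minimizer_eq_chord[of 1 t] eta_cano_lt_1_off_plateau[of 1] True assms
    by (simp add: numeral_2_eq_2)
next
  case False
  have x12: "x 1 < x 2" using M by (intro x_less) auto
  have "hat t (x 1) (x 2) u \<le> 1 - \<bar>\<eta> u\<bar>" for u
  proof -
    consider "u \<le> x 1" | "u \<in> {x 1..x 2}" | "x 2 \<le> u" by force
    then show ?thesis
    proof cases
      case 1
      then show ?thesis using hat_bounds(2)[of t "x 1" "x 2" u] False x12 by (simp add: eta_cano_outside)
    next
      case 2
      then obtain l where l: "0 \<le> l" "l \<le> 1" "u = x 1 + l * (x 2 - x 1)"
        using segment_coordinate[OF x12] by metis
      have "1 \<in> {1..M - 1}" "node_sign 1 = 0" using M by (auto simp: node_sign_def)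
      then have "\<eta> u = l * node_sign 2"
        using eta_cano_segment[of 1 l] l by (simp only: one_add_one)
      then have "\<bar>\<eta> u\<bar> \<le> l" using node_sign_cases[of 2] l(1) by auto
      moreover have "hat t (x 1) (x 2) u \<le> 1 - l"
      proof (cases "u = x 1")
        case True
        then show ?thesis using l x12 hat_bounds(2)[of t "x 1" "x 2" u] False by simp
      next
        case u: False
        have "x 2 - u = (1 - l) * (x 2 - x 1)" using l(3) by (simp add: algebra_simps)
        then have "(x 2 - u) / (x 2 - x 1) = 1 - l" using x12 by simp
        then show ?thesis using u 2 False x12 by (simp add: hat_eq)
      qed
      ultimately show ?thesis by linarith
    next
      case 3
      then show ?thesis using hat_zero[of t "x 1" "x 2" u] False x12 eta_cano_le_1[of u] by simp
    qed
  qed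
  then have "kink f t (x 1) (x 2) = 0"
    using minimizer_kink_zero[of t "x 1" "x 2" 1] False x12 by simp
  then have "(f (x 1) - f t) / (x 1 - t) = (f (x 2) - f (x 1)) / (x 2 - x 1)" by (simp add: kink_def)
  also have "\<dots> = slope x y 1"
    using interp M by (simp add: interpolates_def slope_def numeral_2_eq_2)
  finally have "f (x 1) - f t = slope x y 1 * (x 1 - t)" using False by (simp add: divide_eq_eq)
  then show ?thesis using interp M by (simp add: interpolates_def chord_def algebra_simps)
qed

text \<open>The mirror image of the preceding lemma, with the hat on the nodes \<open>x (M - 1)\<close>, \<open>x M\<close>, \<open>t\<close>.\<close>

lemma minimizer_right:
  assumes "x (M - 1) \<le> t"
  shows "f t = chord (M - 1) t"
proof (cases "t \<le> x M")
  case True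
  have "M - 1 \<in> {1..M - 1}" "M - 1 + 1 = M" using M by auto
  moreover have "\<not> (node_sign (M - 1) = node_sign M \<and> \<bar>node_sign (M - 1)\<bar> = 1)"
    using M node_sign_def[of M] by auto
  ultimately show ?thesis
    using minimizer_eq_chord[of "M - 1" t] eta_cano_lt_1_off_plateau[of "M - 1"] True assms by simp
next
  case False
  let ?p = "x (M - 1)" and ?q = "x M"
  have pq: "?p < ?q" using M by (intro x_less) auto
  have qt: "?q < t" using False by simp
  have "hat ?p ?q t u \<le> 1 - \<bar>\<eta> u\<bar>" for u
  proof -
    consider "u \<le> ?p" | "u \<in> {?p..?q}" | "?q \<le> u" by force
    then show ?thesis
    proof cases
      case 1
      then show ?thesis using hat_zero[OF pq qt, of u] eta_cano_le_1[of u] by simp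
    next
      case 2
      then obtain l where l: "0 \<le> l" "l \<le> 1" "u = ?p + l * (?q - ?p)"
        using segment_coordinate[OF pq] by metis
      have "M - 1 \<in> {1..M - 1}" "M - 1 + 1 = M" "node_sign M = 0"
        using M node_sign_def[of M] by auto
      then have "\<eta> u = (1 - l) * node_sign (M - 1)"
        using eta_cano_segment[of "M - 1" l] l by simp
      then have "\<bar>\<eta> u\<bar> \<le> 1 - l" using node_sign_cases[of "M - 1"] l(2) by auto
      moreover have "hat ?p ?q t u \<le> l"
      proof (cases "u = ?p")
        case True
        then have "hat ?p ?q t u = 0" using hat_zero[OF pq qt] by blast
        then show ?thesis using l(1) by simp
      next
        case u: False
        have "u - ?p = l * (?q - ?p)" using l(3) by (simp add: algebra_simps)
        then have "(u - ?p) / (?q - ?p) = l" using pq by simp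
        then show ?thesis using u 2 pq qt by (simp add: hat_eq)
      qed
      ultimately show ?thesis by linarith
    next
      case 3
      then show ?thesis using hat_bounds(2)[OF pq qt, of u] by (simp add: eta_cano_outside)
    qed
  qed
  then have "kink f ?p ?q t = 0"
    using minimizer_kink_zero[of ?p ?q t 1] pq qt by simp
  then have "(f t - f ?q) / (t - ?q) = (f ?q - f ?p) / (?q - ?p)" by (simp add: kink_def)
  also have "\<dots> = slope x y (M - 1)"
    using interp M by (simp add: interpolates_def slope_def)
  finally have *: "f t - f ?q = slope x y (M - 1) * (t - ?q)" using qt by (simp add: divide_eq_eq)
  have "f ?q = chord (M - 1) ?q"
    using interp M chord_next[of "M - 1"] by (simp add: interpolates_def)
  then show ?thesis using * by (simp add: chord_def algebra_simps)
qed

lemma minimizer_plateau: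
  assumes m: "node_sign m = \<tau>" "node_sign (m + 1) = \<tau>" "\<bar>\<tau>\<bar> = 1"
    and pqr: "x (m - 1) \<le> p" "p < q" "q < r" "r \<le> x (m + 2)"
  shows "\<tau> * kink f p q r \<ge> 0"
proof (rule minimizer_kink_nonneg[OF pqr(2,3) m(3)])
  show "1 + \<tau> * \<eta> q > 0" using plateau_concave(2)[OF m, of q] pqr by simp
  fix t
  show "(1 + \<tau> * \<eta> q) * hat p q r t \<le> 1 + \<tau> * \<eta> t"
  proof (rule concave_ge_hat[OF pqr(2,3), where h = "\<lambda>t. \<tau> * \<eta> t"])
    have "concave_on {x (m - 1)..x (m + 2)} (\<lambda>t. \<tau> * \<eta> t)" by (rule plateau_concave(1)[OF m])
    moreover have "{p..r} \<subseteq> {x (m - 1)..x (m + 2)}" using pqr by auto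
    ultimately show "concave_on {p..r} (\<lambda>t. \<tau> * \<eta> t)"
      unfolding concave_on_def by (rule convex_on_subset) simp
    fix t
    have "\<bar>\<tau> * \<eta> t\<bar> \<le> 1" using eta_cano_le_1[of t] m(3) by (simp add: abs_mult)
    then show "\<tau> * \<eta> t \<ge> - 1" by linarith
  qed
qed

end

context
  assumes tails: "\<And>t. t < x 2 \<or> x (M - 1) < t \<Longrightarrow> f t = fc t"
    and free: "\<And>m t. m \<in> {2..M - 2} \<Longrightarrow> \<forall>u\<in>{x m<..<x (m + 1)}. \<bar>\<eta> u\<bar> < 1 \<Longrightarrow>
      t \<in> {x m..x (m + 1)} \<Longrightarrow> f t = fc t"
    and plateau: "\<And>m \<tau> p q r. node_sign m = \<tau> \<Longrightarrow> node_sign (m + 1) = \<tau> \<Longrightarrow> \<bar>\<tau>\<bar> = 1 \<Longrightarrow>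
      x (m - 1) \<le> p \<Longrightarrow> p < q \<Longrightarrow> q < r \<Longrightarrow> r \<le> x (m + 2) \<Longrightarrow> \<tau> * kink f p q r \<ge> 0"
begin

lemma eq_f_cano_off_plateau:
  assumes m: "m \<in> {1..M - 1}" and no: "\<not> (node_sign m = node_sign (m + 1) \<and> \<bar>node_sign m\<bar> = 1)"
    and t: "t \<in> {x m..x (m + 1)}"
  shows "f t = fc t"
proof -
  have node: "f (x k) = fc (x k)" if "k \<in> {1..M}" for k
    using interp that f_cano_interpolates by (simp add: interpolates_def)
  consider "m = 1" | "m = M - 1" | "m \<in> {2..M - 2}" using m by force
  then show ?thesis
  proof cases
    case 1
    then have "t < x 2 \<or> t = x 2" using t by (auto simp: numeral_2_eq_2)
    then show ?thesis using tails node[of 2] M by auto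
  next
    case 2
    then have "x (M - 1) < t \<or> t = x (M - 1)" using t by auto
    then show ?thesis using tails node[of "M - 1"] M by auto
  next
    case 3
    then show ?thesis using free[OF 3 _ t] eta_cano_lt_1_off_plateau[OF m no] by auto
  qed
qed

text \<open>The converse direction is a local statement: \<open>f\<close> has no kink except where the certificate has modulus 1, and
there the kink has the sign of the certificate. Since the hat with nodes \<open>p, q, r\<close> has no data node inside
its two cells, either \<open>q\<close> lies strictly inside a data interval that contains \<open>p\<close> and \<open>r\<close>, or \<open>q\<close> is a node
\<open>x m\<close> and \<open>p, r\<close> lie in the adjacent intervals. In the latter case, without an adjacent plateau, \<open>f\<close>
agrees with the canonical interpolant on both sides, and the kink is \<open>a m\<close>, which has the sign of \<open>\<eta> (x m)\<close>
by construction.\<close>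

lemma kink_sign:
  assumes pqr: "p < q" "q < r" and gaps: "x ` {1..M} \<inter> {p<..<q} = {}" "x ` {1..M} \<inter> {q<..<r} = {}"
  shows "kink f p q r = 0 \<or> (\<exists>\<tau>. \<bar>\<tau>\<bar> = 1 \<and> \<eta> q = \<tau> \<and> \<tau> * kink f p q r \<ge> 0)"
proof -
  have gap_left: "x k \<le> p" if "k \<in> {1..M}" "x k < q" for k
    using gaps(1) that by (metis disjoint_iff greaterThanLessThan_iff imageI not_le)
  have gap_right: "r \<le> x k" if "k \<in> {1..M}" "q < x k" for k
    using gaps(2) that by (metis disjoint_iff greaterThanLessThan_iff imageI not_le)
  have affine: "kink f p q r = 0"
    if m: "m \<in> {1..M - 1}" and eq: "\<And>t. t \<in> {p, q, r} \<Longrightarrow> f t = fc t"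
      and ends: "m = 1 \<or> x m \<le> p" "m = M - 1 \<or> r \<le> x (m + 1)" for m
  proof -
    have "f t = chord m t" if t: "t \<in> {p, q, r}" for t
      using eq[OF t] f_cano_eq_chord[OF m, of t] ends t pqr by auto
    then have "kink f p q r = kink (chord m) p q r" by (intro kink_cong) auto
    then show ?thesis using kink_affine[OF pqr] by (simp add: chord_def[abs_def])
  qed
  have node: "f (x k) = fc (x k)" if "k \<in> {1..M}" for k
    using interp that f_cano_interpolates by (simp add: interpolates_def)
  have M2: "2 \<in> {1..M}" "M - 1 \<in> {1..M}" "1 \<in> {1..M - 1}" "M - 1 \<in> {1..M - 1}" using M by auto
  consider "q < x 2" | "x (M - 1) < q" | "x 2 \<le> q" "q \<le> x (M - 1)" by linarith
  then show ?thesis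
  proof cases
    case 1
    then have r: "r \<le> x 2" using gap_right[OF M2(1)] by simp
    have "f t = fc t" if "t \<in> {p, q, r}" for t
    proof -
      have "t < x 2 \<or> t = x 2" using that pqr r 1 by auto
      then show ?thesis using tails node[OF M2(1)] by auto
    qed
    then show ?thesis using affine[OF M2(3)] r by (simp add: numeral_2_eq_2)
  next
    case 2
    then have p: "x (M - 1) \<le> p" using gap_left[OF M2(2)] by simp
    have "f t = fc t" if "t \<in> {p, q, r}" for t
    proof -
      have "x (M - 1) < t \<or> t = x (M - 1)" using that pqr p 2 by auto
      then show ?thesis using tails node[OF M2(2)] by auto
    qed
    then show ?thesis using affine[OF M2(4)] p by simp
  next
    case 3
    have "x 1 \<le> x 2" "x (M - 1) < x M" using M by (auto intro!: x_le x_less)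
    then obtain m where m: "m \<in> {1..M - 1}" "x m \<le> q" "q < x (m + 1)"
      using locate[of q] 3 by auto
    have "m \<noteq> 1" using m(3) 3(1) by (auto simp: numeral_2_eq_2)
    then have m2: "m \<in> {2..M - 1}" using m(1) by auto
    have mem: "m \<in> {1..M}" "m + 1 \<in> {1..M}" "m - 1 \<in> {1..M}" "m - 1 \<in> {1..M - 1}" "m - 1 + 1 = m"
      "m - 1 + 2 = m + 1"
      using m2 M by auto
    have r: "r \<le> x (m + 1)" using gap_right[OF mem(2) m(3)] .
    show ?thesis
    proof (cases "q = x m")
      case True
      have p: "x (m - 1) \<le> p" using gap_left[OF mem(3)] x_neighbours[OF m2] True by simp
      have \<eta>q: "\<eta> q = node_sign m" using True eta_cano_node[OF mem(1)] by simp
      consider "node_sign m = node_sign (m + 1)" "\<bar>node_sign m\<bar> = 1"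
        | "node_sign (m - 1) = node_sign m" "\<bar>node_sign m\<bar> = 1"
        | "\<not> (node_sign m = node_sign (m + 1) \<and> \<bar>node_sign m\<bar> = 1)"
          "\<not> (node_sign (m - 1) = node_sign m \<and> \<bar>node_sign (m - 1)\<bar> = 1)"
        by fastforce
      then show ?thesis
      proof cases
        case 1
        then have "m \<in> {2..M - 2}" using plateau_nodes[of m "node_sign m"] by simp
        then have "x (m + 1) \<le> x (m + 2)" using M by (intro x_le) auto
        then have "node_sign m * kink f p q r \<ge> 0"
          using plateau[OF refl 1(1)[symmetric] 1(2) p pqr] r by simp
        then show ?thesis using 1(2) \<eta>q by blast
      next
        case 2
        then have "m - 1 \<in> {2..M - 2}" using plateau_nodes[of "m - 1" "node_sign m"] mem(5) by simp
        then have "x (m - 1 - 1) \<le> x (m - 1)" using M by (intro x_le) auto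
        then have "node_sign m * kink f p q r \<ge> 0"
          using plateau[of "m - 1" "node_sign m" p q r] 2 p pqr r mem(5,6) by simp
        then show ?thesis using 2(2) \<eta>q by blast
      next
        case none: 3
        have "f p = fc p" "f q = fc q" "f r = fc r"
          using eq_f_cano_off_plateau[OF m(1) none(1)] eq_f_cano_off_plateau[OF mem(4)] none(2)
            mem(5) p r pqr True by auto
        then have "kink f p q r = kink fc p q r" by (intro kink_cong)
        also have "\<dots> = a m" using kink_f_cano_at_node[OF m2 p] r pqr True by simp
        finally have k: "kink f p q r = a m" .
        show ?thesis
        proof (cases "a m = 0")
          case False
          then have "\<bar>sgn (a m)\<bar> = 1" "sgn (a m) * a m \<ge> 0" by (auto simp: sgn_if)
          moreover have "\<eta> q = sgn (a m)" using \<eta>q m2 by (simp add: node_sign_def)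
          ultimately show ?thesis using k by metis
        qed (use k in simp)
      qed
    next
      case False
      then have q: "x m < q" using m(2) by simp
      then have p: "x m \<le> p" using gap_left[OF mem(1)] by simp
      show ?thesis
      proof (cases "node_sign m = node_sign (m + 1) \<and> \<bar>node_sign m\<bar> = 1")
        case True
        then have sat: "node_sign (m + 1) = node_sign m" "\<bar>node_sign m\<bar> = 1" by auto
        have "m \<in> {2..M - 2}" by (rule plateau_nodes[OF refl sat])
        then have "x (m - 1) \<le> x m" "x (m + 1) \<le> x (m + 2)" using M by (auto intro!: x_le)
        then have "node_sign m * kink f p q r \<ge> 0"
          using plateau[OF refl sat _ pqr] p r by simp
        moreover have "\<eta> q = node_sign m"
          using eta_cano_plateau[OF refl sat, of q] q m(3) by simp
        ultimately show ?thesis using sat(2) by blast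
      next
        case no: False
        have "f t = fc t" if "t \<in> {p, q, r}" for t
          using that p pqr r by (intro eq_f_cano_off_plateau[OF m(1) no]) auto
        then show ?thesis using affine[OF m(1)] p r by blast
      qed
    qed
  qed
qed

text \<open>For an admissible \<open>g\<close>, the products \<open>(\<eta> q - g q) * kink f p q r\<close> are nonnegative by the sign rule, so the
second derivative of \<open>f\<close> takes a larger value at \<open>\<eta>\<close> than at \<open>g\<close>.\<close>

lemma minimizer_if_conditions: "M_norm (D2 f) \<le> D2 f \<eta>"
proof (rule M_norm_le)
  fix g assume g: "g \<in> C0" "\<And>t. \<bar>g t\<bar> \<le> 1"
  have rep: "represents_D2 (D2 f) f" and cont: "continuous_on UNIV f"
    using represents_D2_D2[OF f] f by (auto simp: BV2_def)
  have R: "D2 f \<in> Radon_measures" using rep by (simp add: represents_D2_def)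
  have "D2 f (\<lambda>t. \<eta> t - g t) \<ge> 0"
  proof (rule Radon_nonneg_if_nonneg_on_hats[OF R C0_diff[OF eta_cano_C0 g(1)], of "x ` {1..M}"])
    fix p q r :: real
    assume pqr: "p < q" "q < r" and gaps: "x ` {1..M} \<inter> {p<..<q} = {}" "x ` {1..M} \<inter> {q<..<r} = {}"
    have "(\<eta> q - g q) * kink f p q r \<ge> 0"
      using kink_sign[OF pqr gaps]
    proof
      assume "\<exists>\<tau>. \<bar>\<tau>\<bar> = 1 \<and> \<eta> q = \<tau> \<and> \<tau> * kink f p q r \<ge> 0"
      then obtain \<tau> where \<tau>: "\<bar>\<tau>\<bar> = 1" "\<eta> q = \<tau>" "\<tau> * kink f p q r \<ge> 0" by blast
      have \<tau>\<tau>: "\<tau> * \<tau> = 1" using \<tau>(1) by (metis abs_mult_self_eq mult_1)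
      \<comment> \<open>\<open>\<eta> q - g q = \<tau> * (1 - \<tau> * g q)\<close> has the sign of \<open>\<tau>\<close> or vanishes, and so does the kink.\<close>
      have "\<bar>\<tau> * g q\<bar> \<le> 1" using g(2)[of q] \<tau>(1) by (simp add: abs_mult)
      then have "0 \<le> 1 - \<tau> * g q" by linarith
      then have "0 \<le> (1 - \<tau> * g q) * (\<tau> * kink f p q r)"
        using \<tau>(3) by (rule mult_nonneg_nonneg)
      also have "\<dots> = (\<tau> - (\<tau> * \<tau>) * g q) * kink f p q r" by (simp add: algebra_simps)
      finally show ?thesis using \<tau>\<tau> \<tau>(2) by simp
    qed simp
    then show "(\<eta> q - g q) * D2 f (hat p q r) \<ge> 0"
      using D2_hat[OF rep cont pqr] by simp
  qed simp
  then show "D2 f g \<le> D2 f \<eta>" using Radon_diff[OF R eta_cano_C0 g(1)] by simp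
qed

end

end

end

section \<open>The characterization\<close>

theorem theorem2:
  fixes M :: nat and x y :: "nat \<Rightarrow> real" and f :: "real \<Rightarrow> real"
  assumes "M \<ge> 4"
    and "strict_mono_on {1..M} x"
    and "f \<in> BV2"
  shows "gBPC_solution M x y f \<longleftrightarrow>
    (\<forall>m\<in>{1..M}. f (x m) = y m) \<and>
    (\<forall>m\<in>{2..M - 2}.
       ((\<forall>t\<in>{x m<..<x (m + 1)}. \<bar>eta_cano M x y t\<bar> < 1) \<longrightarrow>
          (\<forall>t\<in>{x m..x (m + 1)}. f t = f_cano M x y t)) \<and>
       ((\<forall>t\<in>{x m..x (m + 1)}. eta_cano M x y t = 1) \<longrightarrow>
          convex_on {x (m - 1)..x (m + 2)} f) \<and>
       ((\<forall>t\<in>{x m..x (m + 1)}. eta_cano M x y t = - 1) \<longrightarrow>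
          concave_on {x (m - 1)..x (m + 2)} f) \<and>
       (\<forall>t\<in>{..<x 2} \<union> {x (M - 1)<..}. f t = f_cano M x y t))"
    (is "_ \<longleftrightarrow> ?interp \<and> (\<forall>m\<in>{2..M - 2}. ?free m \<and> ?convex m \<and> ?concave m \<and> ?tails)")
proof -
  interpret interpolation_data M x y using assms(1,2) by unfold_locales
  have interp_iff: "?interp \<longleftrightarrow> interpolates M x y f" by (simp add: interpolates_def)
  have saturated: "node_sign m = \<tau> \<and> node_sign (m + 1) = \<tau>"
    if "m \<in> {2..M - 2}" "\<forall>t\<in>{x m..x (m + 1)}. \<eta> t = \<tau>" for m \<tau>
  proof -
    have "x m \<le> x (m + 1)" "m \<in> {1..M}" "m + 1 \<in> {1..M}" using that(1) M by (auto intro!: x_le)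
    then show ?thesis using that(2) eta_cano_node[of m] eta_cano_node[of "m + 1"] by auto
  qed
  show ?thesis
  proof
    assume "gBPC_solution M x y f"
    then have ip: "interpolates M x y f" and opt: "M_norm (D2 f) \<le> D2 f \<eta>"
      using gBPC_solution_iff_dual[OF assms(3)] by auto
    have "?free m \<and> ?convex m \<and> ?concave m \<and> ?tails" if m: "m \<in> {2..M - 2}" for m
    proof (intro conjI impI ballI)
      have m1: "m \<in> {1..M - 1}" using m by auto
      show "f t = fc t" if "\<forall>u\<in>{x m<..<x (m + 1)}. \<bar>\<eta> u\<bar> < 1" "t \<in> {x m..x (m + 1)}" for t
        using minimizer_eq_chord[OF assms(3) ip opt m1, of t] f_cano_eq_chord[OF m1, of t] that by simp
      show "convex_on {x (m - 1)..x (m + 2)} f" if "\<forall>t\<in>{x m..x (m + 1)}. \<eta> t = 1"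
        unfolding convex_on_iff_signed_kink
        using minimizer_plateau[OF assms(3) ip opt, of m 1] saturated[OF m that] by simp
      show "concave_on {x (m - 1)..x (m + 2)} f" if "\<forall>t\<in>{x m..x (m + 1)}. \<eta> t = - 1"
        unfolding convex_on_iff_signed_kink
        using minimizer_plateau[OF assms(3) ip opt, of m "- 1"] saturated[OF m that] by simp
      fix t assume "t \<in> {..<x 2} \<union> {x (M - 1)<..}"
      then consider "t < x 2" | "x (M - 1) < t" by auto
      then show "f t = fc t"
      proof cases
        case 1
        then show ?thesis
          using minimizer_left[OF assms(3) ip opt, of t] f_cano_eq_chord[of 1 t] M
          by (simp add: numeral_2_eq_2)
      next
        case 2
        then show ?thesis
          using minimizer_right[OF assms(3) ip opt, of t] f_cano_eq_chord[of "M - 1" t] M by simp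
      qed
    qed
    then show "?interp \<and> (\<forall>m\<in>{2..M - 2}. ?free m \<and> ?convex m \<and> ?concave m \<and> ?tails)"
      using ip interp_iff by blast
  next
    assume R: "?interp \<and> (\<forall>m\<in>{2..M - 2}. ?free m \<and> ?convex m \<and> ?concave m \<and> ?tails)"
    then have ip: "interpolates M x y f" using interp_iff by blast
    have "2 \<in> {2..M - 2}" using M by simp
    then have tails: "?tails" using R by blast
    have cond: "?free m" "?convex m" "?concave m" if "m \<in> {2..M - 2}" for m using R that by blast+
    have "M_norm (D2 f) \<le> D2 f \<eta>"
    proof (rule minimizer_if_conditions[OF assms(3) ip])
      show "f t = fc t" if "t < x 2 \<or> x (M - 1) < t" for t using tails that by blast
      show "f t = fc t" if "m \<in> {2..M - 2}" "\<forall>u\<in>{x m<..<x (m + 1)}. \<bar>\<eta> u\<bar> < 1"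
        "t \<in> {x m..x (m + 1)}" for m t
        using cond(1)[OF that(1)] that(2,3) by blast
      show "\<tau> * kink f p q r \<ge> 0"
        if \<tau>: "node_sign m = \<tau>" "node_sign (m + 1) = \<tau>" "\<bar>\<tau>\<bar> = 1"
          and pqr: "x (m - 1) \<le> p" "p < q" "q < r" "r \<le> x (m + 2)" for m \<tau> p q r
      proof -
        have m: "m \<in> {2..M - 2}" by (rule plateau_nodes[OF \<tau>])
        have const: "\<forall>t\<in>{x m..x (m + 1)}. \<eta> t = \<tau>" using eta_cano_plateau[OF \<tau>] by blast
        have "\<tau> = 1 \<or> \<tau> = - 1" using \<tau>(3) by linarith
        then show ?thesis
        proof
          assume "\<tau> = 1"
          then have "convex_on {x (m - 1)..x (m + 2)} f" using cond(2)[OF m] const by simp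
          then show ?thesis unfolding convex_on_iff_signed_kink \<open>\<tau> = 1\<close> using pqr by blast
        next
          assume "\<tau> = - 1"
          then have "concave_on {x (m - 1)..x (m + 2)} f" using cond(3)[OF m] const by simp
          then show ?thesis unfolding convex_on_iff_signed_kink \<open>\<tau> = - 1\<close> using pqr by blast
        qed
      qed
    qed
    then show "gBPC_solution M x y f" using gBPC_solution_iff_dual[OF assms(3)] ip by blast
  qed
qed

end
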